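(* Let $G$ be a non-elementary torsion-free hyperbolic group. Then for any integer $k\ge 2$ such that $N_k(G)\neq\emptyset$, the natural epimorphism $\lambda_{G,k}\colon FAC_k(G)\to AC_k(G)$ is an isomorphism.
   Context: "Hyperbolic" means word-hyperbolic in the sense of Gromov. Such a group is non-elementary if it is not virtually cyclic (i.e. it has no cyclic subgroup of finite index). Let $G$ be a group, $k\ge 2$ an integer, and $G^k$ the direct power of $k$ copies of $G$. The elementary Andrews-Curtis transformations (AC-moves) on $G^k$ are the following bijections $G^k\to G^k$, where $1\le i,j\le k$: - $(R_{ij})$: $(u_1,\ldots,u_i,\ldots,u_k)\mapsto (u_1,\ldots,u_iu_j^{\pm1},\ldots,u_k)$, $i\neq j$; - $(L_{ij})$: $(u_1,\ldots,u_i,\ldots,u_k)\mapsto (u_1,\ldots,u_j^{\pm1}u_i,\ldots,u_k)$, $i\neq j$; - $(I_i)$: $(u_1,\ldots,u_i,\ldots,u_k)\mapsto (u_1,\ldots,u_i^{-1},\ldots,u_k)$; - $(C_{i,w})$: $(u_1,\ldots,u_i,\ldots,u_k)\mapsto (u_1,\ldots,u_i^{w},\ldots,u_k)$, $w\in G$, where $u^w=w^{-1}uw$ denotes conjugation. The full Andrews-Curtis group $FAC_k(G)$ is the subgroup of $Sym(G^k)$ generated by all these bijections. $N_k(G)\subseteq G^k$ denotes the set of all $k$-tuples $(u_1,\ldots,u_k)$ whose entries generate $G$ as a normal subgroup (i.e. the normal closure of $\{u_1,\ldots,u_k\}$ in $G$ is $G$). Every elementary AC-transformation restricts to a bijection of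 $N_k(G)$. When $N_k(G)\neq\emptyset$, the Andrews-Curtis group $AC_k(G)$ is the subgroup of $Sym(N_k(G))$ generated by these restricted bijections. The map $\lambda_{G,k}\colon FAC_k(G)\to AC_k(G)$ sends $\alpha\in FAC_k(G)$ to its restriction $\bar\alpha=\alpha|_{N_k(G)}$; it is a surjective group homomorphism. *)

theory Defs
  imports Complex_Main "HOL-Algebra.Algebra" "HOL-Algebra.Bij" "HOL-Algebra.Elementary_Groups"
begin

section \<open>Hyperbolic groups\<close>

definition gromov_product :: "('a \<Rightarrow> 'a \<Rightarrow> real) \<Rightarrow> 'a \<Rightarrow> 'a \<Rightarrow> 'a \<Rightarrow> real" where
  "gromov_product d p x y = (d x p + d y p - d x y) / 2"

text \<open>Gromov's four-point definition; every point serves as base point.\<close>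

definition gromov_hyperbolic :: "real \<Rightarrow> 'a set \<Rightarrow> ('a \<Rightarrow> 'a \<Rightarrow> real) \<Rightarrow> bool" where
  "gromov_hyperbolic \<delta> M d \<longleftrightarrow>
     (\<forall>p\<in>M. \<forall>x\<in>M. \<forall>y\<in>M. \<forall>z\<in>M.
        gromov_product d p x y \<ge> min (gromov_product d p x z) (gromov_product d p z y) - \<delta>)"

text \<open>
  Only meaningful for \<open>g \<in> generate G S\<close>, since otherwise the set below is empty.
\<close>

definition word_length :: "('a, 'b) monoid_scheme \<Rightarrow> 'a set \<Rightarrow> 'a \<Rightarrow> nat" where
  "word_length G S g =
     (LEAST n. \<exists>ws. length ws = n \<and> set ws \<subseteq> S \<union> (\<lambda>s. inv\<^bsub>G\<^esub> s) ` S
                  \<and> foldr (\<lambda>x y. x \<otimes>\<^bsub>G\<^esub> y) ws \<one>\<^bsub>G\<^esub> = g)"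

definition word_metric :: "('a, 'b) monoid_scheme \<Rightarrow> 'a set \<Rightarrow> 'a \<Rightarrow> 'a \<Rightarrow> real" where
  "word_metric G S x y = real (word_length G S (inv\<^bsub>G\<^esub> x \<otimes>\<^bsub>G\<^esub> y))"

definition hyperbolic_group :: "('a, 'b) monoid_scheme \<Rightarrow> bool" where
  "hyperbolic_group G \<longleftrightarrow> group G \<and>
     (\<exists>S \<delta>. finite S \<and> S \<subseteq> carrier G \<and> generate G S = carrier G
          \<and> gromov_hyperbolic \<delta> (carrier G) (word_metric G S))"

definition virtually_cyclic :: "('a, 'b) monoid_scheme \<Rightarrow> bool" where
  "virtually_cyclic G \<longleftrightarrow>
     (\<exists>H. subgroup H G \<and> cyclic_group (subgroup_generated G H) \<and> finite (rcosets\<^bsub>G\<^esub> H))"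

definition torsion_free :: "('a, 'b) monoid_scheme \<Rightarrow> bool" where
  "torsion_free G \<longleftrightarrow>
     (\<forall>x\<in>carrier G. \<forall>n::nat. n > 0 \<and> x [^]\<^bsub>G\<^esub> n = \<one>\<^bsub>G\<^esub> \<longrightarrow> x = \<one>\<^bsub>G\<^esub>)"


section \<open>Andrews-Curtis groups\<close>

text \<open>
  A \<open>k\<close>-tuple over \<open>G\<close> is an extensional function on the index set \<open>{..<k}\<close>
  (so indices run from \<open>0\<close> to \<open>k - 1\<close>).
\<close>

definition tuples :: "('a, 'b) monoid_scheme \<Rightarrow> nat \<Rightarrow> (nat \<Rightarrow> 'a) set" where
  "tuples G k = ({..<k} \<rightarrow>\<^sub>E carrier G)"

definition normal_closure :: "('a, 'b) monoid_scheme \<Rightarrow> 'a set \<Rightarrow> 'a set" where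
  "normal_closure G A = \<Inter> {N. N \<lhd> G \<and> A \<subseteq> N}"

definition normal_generating_tuples :: "('a, 'b) monoid_scheme \<Rightarrow> nat \<Rightarrow> (nat \<Rightarrow> 'a) set" where
  "normal_generating_tuples G k =
     {u \<in> tuples G k. normal_closure G (u ` {..<k}) = carrier G}"

text \<open>
  The moves are restricted to \<^term>\<open>tuples G k\<close> because the elements of
  \<^term>\<open>BijGroup (tuples G k)\<close> are extensional.
\<close>

inductive_set AC_moves :: "('a, 'b) monoid_scheme \<Rightarrow> nat \<Rightarrow> ((nat \<Rightarrow> 'a) \<Rightarrow> (nat \<Rightarrow> 'a)) set"
  for G (structure) and k :: nat where
  R: "\<lbrakk>i < k; j < k; i \<noteq> j; e \<in> {1, -1 :: int}\<rbrakk> \<Longrightarrow>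
        (\<lambda>u\<in>tuples G k. u(i := u i \<otimes> (u j [^] e))) \<in> AC_moves G k"
| L: "\<lbrakk>i < k; j < k; i \<noteq> j; e \<in> {1, -1 :: int}\<rbrakk> \<Longrightarrow>
        (\<lambda>u\<in>tuples G k. u(i := (u j [^] e) \<otimes> u i)) \<in> AC_moves G k"
| I: "i < k \<Longrightarrow> (\<lambda>u\<in>tuples G k. u(i := inv (u i))) \<in> AC_moves G k"
| C: "\<lbrakk>i < k; w \<in> carrier G\<rbrakk> \<Longrightarrow>
        (\<lambda>u\<in>tuples G k. u(i := inv w \<otimes> u i \<otimes> w)) \<in> AC_moves G k"

text \<open>
  \<^term>\<open>subgroup_generated\<close> intersects its generating set with the carrier. The next lemmas show
  that the moves, and their restrictions to \<^term>\<open>normal_generating_tuples G k\<close>, are bijections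
  of the respective sets, so that no generator is discarded in \<open>FAC\<close> and \<open>AC\<close> below.
\<close>

lemma (in group) fun_upd_bij_tuples:
  assumes i: "i < k"
    and f: "\<And>u. u \<in> tuples G k \<Longrightarrow> f u \<in> carrier G" and g: "\<And>u. u \<in> tuples G k \<Longrightarrow> g u \<in> carrier G"
    and fg: "\<And>u. u \<in> tuples G k \<Longrightarrow> f (u(i := g u)) = u i"
    and gf: "\<And>u. u \<in> tuples G k \<Longrightarrow> g (u(i := f u)) = u i"
  shows "(\<lambda>u\<in>tuples G k. u(i := f u)) \<in> carrier (BijGroup (tuples G k))"
proof -
  have t: "u(i := x) \<in> tuples G k" if "u \<in> tuples G k" "x \<in> carrier G" for u x
    using that i by (auto simp: tuples_def PiE_iff extensional_def)
  have "bij_betw (\<lambda>u. u(i := f u)) (tuples G k) (tuples G k)"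
    by (rule bij_betw_byWitness[where f' = "\<lambda>u. u(i := g u)"])
       (auto simp: t f g fg gf)
  thus ?thesis by (simp add: BijGroup_def Bij_def)
qed

lemma (in group) AC_moves_subset_BijGroup: "AC_moves G k \<subseteq> carrier (BijGroup (tuples G k))"
proof
  fix \<alpha> assume "\<alpha> \<in> AC_moves G k"
  then show "\<alpha> \<in> carrier (BijGroup (tuples G k))"
  proof cases
    case (R i j e)
    have c: "u i \<in> carrier G" "u j \<in> carrier G" if "u \<in> tuples G k" for u using that R by (auto simp: tuples_def)
    show ?thesis unfolding R(1)
      by (rule fun_upd_bij_tuples[where g = "\<lambda>u. u i \<otimes> (u j [^] (-e))"]) (use R c in \<open>auto simp: m_assoc int_pow_neg\<close>)
  next
    case (L i j e)
    have c: "u i \<in> carrier G" "u j \<in> carrier G" if "u \<in> tuples G k" for u using that L by (auto simp: tuples_def)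
    show ?thesis unfolding L(1)
      by (rule fun_upd_bij_tuples[where g = "\<lambda>u. (u j [^] (-e)) \<otimes> u i"]) (use L c in \<open>auto simp: m_assoc[symmetric] int_pow_neg\<close>)
  next
    case (I i)
    have c: "u i \<in> carrier G" if "u \<in> tuples G k" for u using that I by (auto simp: tuples_def)
    show ?thesis unfolding I(1)
      by (rule fun_upd_bij_tuples[where g = "\<lambda>u. inv (u i)"]) (use I c in auto)
  next
    case (C i w)
    have c: "u i \<in> carrier G" if "u \<in> tuples G k" for u using that C by (auto simp: tuples_def)
    have l: "inv w \<otimes> (w \<otimes> x) = x" "w \<otimes> (inv w \<otimes> x) = x" if "x \<in> carrier G" for x
      using that C by (auto simp: m_assoc[symmetric])
    show ?thesis unfolding C(1)
      by (rule fun_upd_bij_tuples[where g = "\<lambda>u. w \<otimes> u i \<otimes> inv w"]) (use C c l in \<open>auto simp: m_assoc\<close>)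
  qed
qed

lemma (in group) normal_closure_eqI:
  assumes "\<And>N. N \<lhd> G \<Longrightarrow> A \<subseteq> N \<longleftrightarrow> B \<subseteq> N"
  shows "normal_closure G A = normal_closure G B"
  using assms unfolding normal_closure_def by (metis (mono_tags, lifting))

lemma (in group) normal_closure_fun_upd:
  assumes i: "i < k" and "\<And>N. N \<lhd> G \<Longrightarrow> \<forall>j<k. j \<noteq> i \<longrightarrow> u j \<in> N \<Longrightarrow> x \<in> N \<longleftrightarrow> u i \<in> N"
  shows "normal_closure G ((u(i := x)) ` {..<k}) = normal_closure G (u ` {..<k})"
  by (rule normal_closure_eqI) (use assms in \<open>auto simp: image_subset_iff\<close>)

lemma (in group) normal_closure_AC_moves: assumes "\<alpha> \<in> AC_moves G k" "u \<in> tuples G k"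
  shows "normal_closure G (\<alpha> u ` {..<k}) = normal_closure G (u ` {..<k})"
  using assms(1)
proof cases
  case (R i j e)
  have c: "u i \<in> carrier G" "u j \<in> carrier G" using assms R by (auto simp: tuples_def)
  show ?thesis using assms(2) apply (simp add: R(1) del: fun_upd_apply)
  proof (rule normal_closure_fun_upd[OF \<open>i<k\<close>])
    fix N assume N: "N \<lhd> G" "\<forall>j<k. j \<noteq> i \<longrightarrow> u j \<in> N"
    interpret N: normal N G by fact
    have j: "u j [^] e \<in> N" using N R c by (auto simp: int_pow_neg)
    show "(u i \<otimes> u j [^] e \<in> N) = (u i \<in> N)" 
      using j c N.m_closed N.m_inv_closed by (metis inv_solve_right' int_pow_closed N.mem_carrier)
  qed
next
  case (L i j e)
  have c: "u i \<in> carrier G" "u j \<in> carrier G" using assms L by (auto simp: tuples_def)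
  show ?thesis using assms(2) apply (simp add: L(1) del: fun_upd_apply)
  proof (rule normal_closure_fun_upd[OF \<open>i<k\<close>])
    fix N assume N: "N \<lhd> G" "\<forall>j<k. j \<noteq> i \<longrightarrow> u j \<in> N"
    interpret N: normal N G by fact
    have j: "u j [^] e \<in> N" using N L c by (auto simp: int_pow_neg)
    show "(u j [^] e \<otimes> u i \<in> N) = (u i \<in> N)" 
      using j c N.m_closed N.m_inv_closed by (metis inv_solve_left' int_pow_closed N.mem_carrier)
  qed
next
  case (I i)
  have c: "u i \<in> carrier G" using assms I by (auto simp: tuples_def)
  show ?thesis using assms(2) apply (simp add: I(1) del: fun_upd_apply)
  proof (rule normal_closure_fun_upd[OF \<open>i<k\<close>])
    fix N assume N: "N \<lhd> G"
    interpret N: normal N G by fact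
    show "(inv (u i) \<in> N) = (u i \<in> N)" using c by (metis N.m_inv_closed inv_inv)
  qed
next
  case (C i w)
  have c: "u i \<in> carrier G" using assms C by (auto simp: tuples_def)
  show ?thesis using assms(2) apply (simp add: C(1) del: fun_upd_apply)
  proof (rule normal_closure_fun_upd[OF \<open>i<k\<close>])
    fix N assume N: "N \<lhd> G"
    interpret N: normal N G by fact
    show "(inv w \<otimes> u i \<otimes> w \<in> N) = (u i \<in> N)" using c C
      by (smt (verit, ccfv_SIG) N.inv_op_closed1 N.inv_op_closed2 inv_closed inv_inv inv_solve_left m_assoc m_closed inv_solve_right)
  qed
qed

lemma (in group) restrict_AC_moves_subset_BijGroup:
  "(\<lambda>\<alpha>. restrict \<alpha> (normal_generating_tuples G k)) ` AC_moves G k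
     \<subseteq> carrier (BijGroup (normal_generating_tuples G k))"
proof clarify
  fix \<alpha> assume a: "\<alpha> \<in> AC_moves G k"
  have b: "bij_betw \<alpha> (tuples G k) (tuples G k)" using a AC_moves_subset_BijGroup[of k] by (auto simp: BijGroup_def Bij_def)
  have "bij_betw \<alpha> (normal_generating_tuples G k) (normal_generating_tuples G k)"
    unfolding bij_betw_def
  proof
    show "inj_on \<alpha> (normal_generating_tuples G k)"
      using b by (auto simp: bij_betw_def normal_generating_tuples_def intro: inj_on_subset)
    show "\<alpha> ` normal_generating_tuples G k = normal_generating_tuples G k"
    proof (intro equalityI subsetI)
      fix x assume "x \<in> \<alpha> ` normal_generating_tuples G k"
      then show "x \<in> normal_generating_tuples G k" using normal_closure_AC_moves[OF a] b by (auto simp: normal_generating_tuples_def bij_betw_def)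
    next
      fix x assume x: "x \<in> normal_generating_tuples G k"
      then have "x \<in> \<alpha> ` tuples G k" using b by (auto simp: normal_generating_tuples_def bij_betw_def)
      with x show "x \<in> \<alpha> ` normal_generating_tuples G k" using normal_closure_AC_moves[OF a] by (auto simp: normal_generating_tuples_def)
    qed
  qed
  then show "restrict \<alpha> (normal_generating_tuples G k) \<in> carrier (BijGroup (normal_generating_tuples G k))"
    by (simp add: BijGroup_def Bij_def)
qed

definition FAC :: "('a, 'b) monoid_scheme \<Rightarrow> nat \<Rightarrow> ((nat \<Rightarrow> 'a) \<Rightarrow> (nat \<Rightarrow> 'a)) monoid" where
  "FAC G k = subgroup_generated (BijGroup (tuples G k)) (AC_moves G k)"

definition AC :: "('a, 'b) monoid_scheme \<Rightarrow> nat \<Rightarrow> ((nat \<Rightarrow> 'a) \<Rightarrow> (nat \<Rightarrow> 'a)) monoid" where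
  "AC G k = subgroup_generated (BijGroup (normal_generating_tuples G k))
              ((\<lambda>\<alpha>. restrict \<alpha> (normal_generating_tuples G k)) ` AC_moves G k)"

definition AC_restriction ::
  "('a, 'b) monoid_scheme \<Rightarrow> nat \<Rightarrow> ((nat \<Rightarrow> 'a) \<Rightarrow> (nat \<Rightarrow> 'a)) \<Rightarrow> ((nat \<Rightarrow> 'a) \<Rightarrow> (nat \<Rightarrow> 'a))" where
  "AC_restriction G k = (\<lambda>\<alpha>\<in>carrier (FAC G k). restrict \<alpha> (normal_generating_tuples G k))"

end

theory Submission
  imports Defs
begin

text \<open>
  Surjectivity of the restriction map is clear from the generators, so injectivity is the point. An
  element of \<open>FAC G k\<close> acts by words: each entry of the image of a tuple is a product of constants
  of \<open>G\<close> and of entries of the tuple and their inverses. Injectivity therefore says that a system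
  of equations with constants, of the form \<open>w\<^sub>i(u) = u\<^sub>i\<close>, holds on all of \<open>G\<^sup>k\<close> as soon as it
  holds on the normally generating tuples.

  These tuples are plentiful in every single coordinate: if \<open>u\<close> generates \<open>G\<close> normally and \<open>H\<close> is
  the normal closure of the entries other than \<open>u\<^sub>s\<close>, then \<open>u\<^sub>s\<close> may be replaced by any element of
  the coset \<open>u\<^sub>s H\<close>. So it is enough to know that an equation in one variable that holds on a coset
  of a nontrivial normal subgroup holds everywhere (\<open>polynomial_map_vanishing_on_coset\<close>). The
  coordinates are then set free one after the other (\<open>FAC_fixing_normal_generating_tuples\<close>). The
  induction runs over tuples with two nontrivial entries, because for them each of the subgroups
  \<open>H\<close> is nontrivial; staying among such tuples costs at most one point of each coset, so the
  statement about one variable tolerates an exceptional point.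

  After a translation by the coset representative, the equation in one variable becomes
  \<open>c\<^sub>0 x\<^sup>\<plusminus> c\<^sub>1 x\<^sup>\<plusminus> \<dots> c\<^sub>n = 1\<close>, without a subword \<open>x 1 x\<inverse>\<close> or \<open>x\<inverse> 1 x\<close>, and it is refuted at
  \<open>x = h\<^sup>N\<close> for a suitable \<open>h \<in> H\<close> and large \<open>N\<close>. The powers of \<open>h\<close> run along a quasi-geodesic line
  (\<open>quasi_axis_exists\<close>), and the left side is the end of a broken path with long sides
  \<open>h\<^sup>\<plusminus>\<^sup>N\<close>. By the local-to-global principle (\<open>chain_lemma\<close>) such a path does not close up if it
  backtracks by a bounded amount at each corner. A long backtracking at the corner \<open>c\<close> makes the
  axis of \<open>h\<close> and its translate by \<open>c\<close> run together for a long time, and counting the elements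
  of a ball then yields a relation \<open>c h\<^sup>p c\<inverse> = h\<^sup>q\<close> with nonzero exponents
  (\<open>bounded_overlap_or_commensurates\<close>).

  It remains to choose \<open>h\<close> such that none of the finitely many nontrivial constants commensurates it
  in this sense (\<open>normal_subgroup_generic_element\<close>). Here both hypotheses on \<open>G\<close> enter. Since \<open>G\<close>
  is torsion-free, a nontrivial \<open>c\<close> that commensurates \<open>h\<close> has a nonzero power in common with \<open>h\<close>
  (\<open>commensurates_common_power\<close>), hence cannot commensurate two elements without a common power.
  Since \<open>G\<close> is not virtually cyclic, \<open>H\<close> contains infinitely many elements of which no two have a
  nonzero power in common.
\<close>

section \<open>Hyperbolic length functions on groups\<close>

text \<open>
  The word metric enters through the length function \<open>len\<close>, the distance to \<open>\<one>\<close>. Of the existence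
  of geodesics only midpoints up to rounding are kept; finiteness of the balls is the source of all
  counting arguments.
\<close>

locale hyperbolic_length = group G for G (structure) +
  fixes len :: "'a \<Rightarrow> real" and \<delta> :: real
  assumes len_one: "len \<one> = 0"
    and len_inv: "x \<in> carrier G \<Longrightarrow> len (inv x) = len x"
    and len_mult: "x \<in> carrier G \<Longrightarrow> y \<in> carrier G \<Longrightarrow> len (x \<otimes> y) \<le> len x + len y"
    and finite_ball: "finite {x \<in> carrier G. len x \<le> r}"
    and midpoint: "x \<in> carrier G \<Longrightarrow>
      \<exists>m\<in>carrier G. len m + len (inv m \<otimes> x) = len x \<and> \<bar>len m - len (inv m \<otimes> x)\<bar> \<le> 1"
    and hyperbolic: "gromov_hyperbolic \<delta> (carrier G) (\<lambda>x y. len (inv x \<otimes> y))"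
    and delta_nonneg: "0 \<le> \<delta>"
begin

definition ldist :: "'a \<Rightarrow> 'a \<Rightarrow> real" where
  "ldist x y = len (inv x \<otimes> y)"

abbreviation gp :: "'a \<Rightarrow> 'a \<Rightarrow> 'a \<Rightarrow> real" where
  "gp \<equiv> gromov_product ldist"

lemma len_nonneg: "x \<in> carrier G \<Longrightarrow> 0 \<le> len x"
  using len_mult[of x "inv x"] by (simp add: len_one len_inv)

lemma ldist_nonneg: "x \<in> carrier G \<Longrightarrow> y \<in> carrier G \<Longrightarrow> 0 \<le> ldist x y"
  by (simp add: ldist_def len_nonneg)

lemma ldist_one_left [simp]: "x \<in> carrier G \<Longrightarrow> ldist \<one> x = len x"
  by (simp add: ldist_def)

lemma ldist_self [simp]: "x \<in> carrier G \<Longrightarrow> ldist x x = 0"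
  by (simp add: ldist_def len_one)

lemma ldist_commute: assumes "x \<in> carrier G" "y \<in> carrier G" shows "ldist x y = ldist y x"
  using len_inv[of "inv x \<otimes> y"] assms by (simp add: ldist_def inv_mult_group)

lemma ldist_one_right [simp]: "x \<in> carrier G \<Longrightarrow> ldist x \<one> = len x"
  by (simp add: ldist_def len_inv)

lemma ldist_left: assumes "g \<in> carrier G" "x \<in> carrier G" "y \<in> carrier G"
  shows "ldist (g \<otimes> x) (g \<otimes> y) = ldist x y"
proof -
  have "inv (g \<otimes> x) \<otimes> (g \<otimes> y) = inv x \<otimes> (inv g \<otimes> g) \<otimes> y"
    using assms by (simp only: inv_mult_group m_assoc inv_closed m_closed)
  then show ?thesis using assms by (simp add: ldist_def)
qed

lemma ldist_right: assumes "x \<in> carrier G" "y \<in> carrier G" shows "ldist x (x \<otimes> y) = len y"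
  using ldist_left[of x \<one> y] assms by simp

lemma ldist_triangle: assumes "x \<in> carrier G" "y \<in> carrier G" "z \<in> carrier G"
  shows "ldist x z \<le> ldist x y + ldist y z"
proof -
  have "inv x \<otimes> z = (inv x \<otimes> y) \<otimes> (inv y \<otimes> z)"
    using assms by (metis inv_closed inv_solve_left m_assoc m_closed)
  then show ?thesis using assms len_mult by (simp add: ldist_def)
qed

lemma gp_left: assumes "g \<in> carrier G" "p \<in> carrier G" "x \<in> carrier G" "y \<in> carrier G"
  shows "gp (g \<otimes> p) (g \<otimes> x) (g \<otimes> y) = gp p x y"
  using assms by (simp add: gromov_product_def ldist_left)

lemma gp_commute: assumes "x \<in> carrier G" "y \<in> carrier G" shows "gp p x y = gp p y x"
  using assms by (simp add: gromov_product_def ldist_commute)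

lemma gp_hyp: assumes "p \<in> carrier G" "x \<in> carrier G" "y \<in> carrier G" "z \<in> carrier G"
  shows "min (gp p x z) (gp p z y) - \<delta> \<le> gp p x y"
  using hyperbolic assms unfolding gromov_hyperbolic_def ldist_def by blast

text \<open>
  The base point is eliminated: of the three sums of two opposite distances among four points, the
  two largest ones differ by at most \<open>2 * \<delta>\<close>.
\<close>

lemma four_point: assumes "x \<in> carrier G" "y \<in> carrier G" "z \<in> carrier G" "w \<in> carrier G"
  shows "ldist x y + ldist z w \<le> max (ldist x z + ldist y w) (ldist x w + ldist y z) + 2 * \<delta>"
  using gp_hyp[of w x y z] assms ldist_commute[of y z]
  unfolding gromov_product_def by (auto simp: min_def max_def field_simps split: if_splits)

lemma gp_move_base: assumes "p \<in> carrier G" "q \<in> carrier G" "x \<in> carrier G" "y \<in> carrier G"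
  shows "gp p x y \<le> gp q x y + ldist p q"
  using ldist_triangle[of x q p] ldist_triangle[of y q p] ldist_commute[of p q] assms
  unfolding gromov_product_def by (simp add: field_simps)

lemma gp_move_right: assumes "p \<in> carrier G" "x \<in> carrier G" "y \<in> carrier G" "z \<in> carrier G"
  shows "gp p x y \<le> gp p x z + ldist y z"
  using ldist_triangle[of y z p] ldist_triangle[of x y z] assms
  unfolding gromov_product_def by (simp add: field_simps)

lemma gp_nonneg: assumes "p \<in> carrier G" "x \<in> carrier G" "y \<in> carrier G" shows "0 \<le> gp p x y"
  using ldist_triangle[of x p y] ldist_commute[of p y] assms by (simp add: gromov_product_def)

lemma gp_le: assumes "p \<in> carrier G" "x \<in> carrier G" "y \<in> carrier G"
  shows "gp p x y \<le> ldist x p"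
  using ldist_triangle[of y x p] ldist_commute[of x y] assms
  unfolding gromov_product_def by (simp add: field_simps)

lemma gp_swap: assumes "p \<in> carrier G" "x \<in> carrier G" "y \<in> carrier G"
  shows "gp p x y = ldist x p - gp x p y"
  using ldist_commute[of x p] ldist_commute[of y p] ldist_commute[of x y] assms
  unfolding gromov_product_def by (simp add: field_simps)

text \<open>
  A bound on \<open>gp x p q\<close> means that \<open>x\<close> lies near the geodesics from \<open>p\<close> to \<open>q\<close>. Up to a bounded
  error, such points are determined by their distance from \<open>p\<close>.
\<close>

lemma near_geodesic_close:
  assumes "p \<in> carrier G" "q \<in> carrier G" "x \<in> carrier G" "y \<in> carrier G"
    and "gp x p q \<le> C" "gp y p q \<le> C" "\<bar>ldist p x - ldist p y\<bar> \<le> K"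
  shows "ldist x y \<le> 2 * C + K + 2 * \<delta>"
  using four_point[of x y p q] assms ldist_commute[of p x] ldist_commute[of p y] ldist_commute[of q x] ldist_commute[of q y]
  unfolding gromov_product_def by (auto simp: field_simps max_def split: if_splits)

section \<open>Local to global\<close>

text \<open>
  A list of group elements is read as the sides of a broken path, with \<open>c\<close> bounding the backtracking
  at the corners. The induction starts from the far end: the rest \<open>P\<close> of the path has little overlap
  with the inverse of the side \<open>t\<close> before it, so \<open>t \<otimes> P\<close> starts out along \<open>t\<close> for longer than
  \<open>c + \<delta>\<close>. At the corner between \<open>s\<close> and \<open>t\<close> it therefore looks like \<open>t\<close>, up to an error \<open>\<delta>\<close> that
  does not accumulate.
\<close>

lemma chain_lemma:
  assumes L: "2 * c + 2 * \<delta> < L"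
    and "successively (\<lambda>s t. gp \<one> (inv s) t \<le> c) (s # ss)"
    and "\<forall>t\<in>set (s # ss). t \<in> carrier G \<and> L \<le> len t" and "ss \<noteq> []"
  shows "foldr (\<otimes>) ss \<one> \<in> carrier G \<and> L \<le> len (foldr (\<otimes>) ss \<one>) \<and> gp \<one> (inv s) (foldr (\<otimes>) ss \<one>) \<le> c + \<delta>"
  using assms(2-)
proof (induction ss arbitrary: s)
  case (Cons t ts)
  have s: "s \<in> carrier G" "L \<le> len s" and t: "t \<in> carrier G" "L \<le> len t"
    and st: "gp \<one> (inv s) t \<le> c" using Cons.prems by auto
  show ?case
  proof (cases "ts = []")
    case True
    then show ?thesis using s t st delta_nonneg by simp
  next
    case False
    define P where "P = foldr (\<otimes>) ts \<one>"
    have P: "P \<in> carrier G" "L \<le> len P" "gp \<one> (inv t) P \<le> c + \<delta>"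
      using Cons.IH[of t] Cons.prems False unfolding P_def by auto
    have "ldist (inv t) P = len (t \<otimes> P)" using t P by (simp add: ldist_def)
    then have l: "len (t \<otimes> P) = len t + len P - 2 * gp \<one> (inv t) P"
      using t P by (simp add: gromov_product_def len_inv field_simps)
    have r: "gp \<one> t (t \<otimes> P) = len t - gp \<one> (inv t) P"
      using t P l ldist_right[of t P] by (simp add: gromov_product_def)
    have "min (gp \<one> (inv s) (t \<otimes> P)) (gp \<one> (t \<otimes> P) t) - \<delta> \<le> gp \<one> (inv s) t"
      using s t P by (intro gp_hyp) auto
    moreover have "gp \<one> (t \<otimes> P) t > c + \<delta>" using r P t L gp_commute[of t "t \<otimes> P"] by auto
    ultimately have "gp \<one> (inv s) (t \<otimes> P) \<le> c + \<delta>" using st by linarith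
    moreover have "L \<le> len (t \<otimes> P)" using l P t L by linarith
    ultimately show ?thesis using t P by (simp add: P_def)
  qed
qed simp

lemma chain_length:
  assumes L: "2 * c + 2 * \<delta> < L"
    and s: "successively (\<lambda>s t. gp \<one> (inv s) t \<le> c) ss"
    and l: "\<forall>t\<in>set ss. t \<in> carrier G \<and> L \<le> len t" and "ss \<noteq> []"
  shows "L \<le> len (foldr (\<otimes>) ss \<one>)"
proof -
  obtain t ts where ss: "ss = t # ts" using \<open>ss \<noteq> []\<close> by (cases ss) auto
  have t: "t \<in> carrier G" "L \<le> len t" using l ss by auto
  show ?thesis
  proof (cases "ts = []")
    case True
    then show ?thesis using t ss by simp
  next
    case False
    let ?P = "foldr (\<otimes>) ts \<one>"
    have P: "?P \<in> carrier G" "L \<le> len ?P" "gp \<one> (inv t) ?P \<le> c + \<delta>"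
      using chain_lemma[OF L, of t ts] s l ss False by auto
    have "ldist (inv t) ?P = len (t \<otimes> ?P)" using t P by (simp add: ldist_def)
    then have "len (t \<otimes> ?P) = len t + len ?P - 2 * gp \<one> (inv t) ?P"
      using t P by (simp add: gromov_product_def len_inv field_simps)
    then show ?thesis using P t L ss by simp
  qed
qed

lemma foldr_mult_replicate: "f \<in> carrier G \<Longrightarrow> foldr (\<otimes>) (replicate n f) \<one> = f [^] (n::nat)"
  by (induction n) (simp_all add: nat_pow_Suc2[symmetric] del: nat_pow_Suc)

lemma successively_replicate: "P x x \<Longrightarrow> successively P (replicate n x)"
proof (induction n)
  case (Suc n)
  then show ?case by (cases n) auto
qed simp

lemma chain_power:
  assumes "2 * c + 2 * \<delta> < L" "f \<in> carrier G" "gp \<one> (inv f) f \<le> c" "L \<le> len f" "0 < n"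
  shows "gp \<one> (inv f) (f [^] (n::nat)) \<le> c + \<delta>"
proof -
  have "replicate n f \<noteq> []" using assms by simp
  then show ?thesis
    using chain_lemma[of c L f "replicate n f"] assms
      successively_replicate[of "\<lambda>s t. gp \<one> (inv s) t \<le> c" f "Suc n"] foldr_mult_replicate[of f n]
    by auto
qed

text \<open>
  The bounds for the two rays of powers of \<open>f\<close> are combined: \<open>f\<^sup>j\<close> starts out along \<open>f\<close> for longer
  than \<open>c + 2 * \<delta>\<close>, hence overlaps with \<open>inv f\<^sup>i\<close> about as little as \<open>f\<close> does.
\<close>

lemma chain_power_two_sided:
  assumes L: "2 * c + 3 * \<delta> < L" and c: "0 \<le> c" and f: "f \<in> carrier G" "gp \<one> (inv f) f \<le> c" "L \<le> len f"
  shows "gp \<one> (inv f [^] (i::nat)) (f [^] (j::nat)) \<le> c + 2 * \<delta>"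
proof (cases "i = 0 \<or> j = 0")
  case True
  then show ?thesis using f c delta_nonneg by (auto simp: gromov_product_def len_one)
next
  case False
  then obtain j' where j': "j = Suc j'" by (cases j) auto
  have L2: "2 * c + 2 * \<delta> < L" using L delta_nonneg by simp
  have A: "gp \<one> f (inv f [^] i) \<le> c + \<delta>"
    using chain_power[OF L2, of "inv f" i] f False gp_commute[of "inv f" f \<one>] by (simp add: len_inv)
  have B: "gp \<one> (inv f) (f [^] j') \<le> c + \<delta>"
    using chain_power[OF L2, of f j'] f c delta_nonneg
    by (cases "j' = 0") (auto simp: gromov_product_def len_one)
  have fj: "f [^] j = f \<otimes> f [^] j'" using f j' by (simp add: nat_pow_Suc2[symmetric] del: nat_pow_Suc)
  have "gp \<one> f (f [^] j) = len f - gp f \<one> (f [^] j)"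
    using gp_swap[of \<one> f "f [^] j"] f by simp
  also have "gp f \<one> (f [^] j) = gp \<one> (inv f) (f [^] j')"
    using gp_left[of f \<one> "inv f" "f [^] j'"] f fj by simp
  finally have "gp \<one> f (f [^] j) > c + 2 * \<delta>" using B L f by linarith
  moreover have "min (gp \<one> f (f [^] j)) (gp \<one> (f [^] j) (inv f [^] i)) - \<delta> \<le> gp \<one> f (inv f [^] i)"
    using f by (intro gp_hyp) auto
  ultimately have "gp \<one> (f [^] j) (inv f [^] i) \<le> c + 2 * \<delta>" using A by linarith
  then show ?thesis using f gp_commute by simp
qed

section \<open>Elements of infinite order have quasi-axes\<close>

text \<open>
  If \<open>g\<close> moves both ends of a segment from \<open>\<one>\<close> to \<open>z\<close> by little compared with its length, then it
  shifts the middle part along the segment. The point \<open>m\<close> and its images \<open>a = g \<otimes> m\<close> and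
  \<open>b = inv g \<otimes> m\<close> all lie near the segment, and the shift from \<open>b\<close> to \<open>m\<close> equals the shift from \<open>m\<close>
  to \<open>a\<close> up to \<open>2 * \<delta>\<close>, including its sign. Hence \<open>a\<close> and \<open>b\<close> are on opposite sides of \<open>m\<close>.
\<close>

lemma translation_along_segment:
  assumes g: "g \<in> carrier G" and m: "m \<in> carrier G" and z: "z \<in> carrier G"
    and gz: "ldist z (g \<otimes> z) \<le> B" and lg: "len g \<le> B"
    and mz: "ldist \<one> m + ldist m z = len z"
    and far: "ldist \<one> m \<ge> 2 * B + 8 * \<delta> + 1" "ldist m z \<ge> 2 * B + 8 * \<delta> + 1"
  shows "gp m (inv g \<otimes> m) (g \<otimes> m) \<le> 7 * \<delta>"
proof -
  define a where "a = g \<otimes> m"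
  define b where "b = inv g \<otimes> m"
  have ca: "a \<in> carrier G" "b \<in> carrier G" "inv g \<in> carrier G" using g m by (auto simp: a_def b_def)
  have "z = g \<otimes> (inv g \<otimes> z)" using g z by (simp add: m_assoc[symmetric])
  then have igz: "ldist z (inv g \<otimes> z) \<le> B"
    using ldist_left[of g z "inv g \<otimes> z"] ldist_commute[of z "g \<otimes> z"] g z gz by simp
  have gpm: "gp m \<one> z = 0" using mz m z ldist_commute[of z m] by (simp add: gromov_product_def)
  \<comment> \<open>\<open>t \<otimes> m\<close> lies on the translated segment from \<open>t\<close> to \<open>t \<otimes> z\<close>, so far from its ends that replacing
    each end by the nearby end of the original segment costs only \<open>\<delta>\<close>.\<close>
  have near: "gp (t \<otimes> m) \<one> z \<le> 2 * \<delta>"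
    if t: "t \<in> carrier G" "len t \<le> B" "ldist z (t \<otimes> z) \<le> B" for t
  proof -
    let ?x = "t \<otimes> m"
    have c: "?x \<in> carrier G" "t \<otimes> z \<in> carrier G" using t m z by auto
    have B0: "0 \<le> B" using t len_nonneg[of t] by simp
    have 0: "gp ?x t (t \<otimes> z) = 0" using gp_left[of t m \<one> z] t m z gpm by simp
    have d1: "ldist ?x t = ldist \<one> m" using ldist_left[of t m \<one>] t m by simp
    have d2: "ldist ?x (t \<otimes> z) = ldist m z" using ldist_left[of t m z] t m z by simp
    have "ldist ?x t \<le> ldist ?x \<one> + B" using ldist_triangle[of ?x \<one> t] c t by simp
    then have "gp ?x t \<one> > 2 * \<delta>" using d1 far t c delta_nonneg B0 ldist_commute[of t ?x] ldist_commute[of \<one> ?x]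
      by (simp add: gromov_product_def)
    moreover have "min (gp ?x t \<one>) (gp ?x \<one> (t \<otimes> z)) - \<delta> \<le> gp ?x t (t \<otimes> z)"
      using c t by (intro gp_hyp) auto
    ultimately have 1: "gp ?x \<one> (t \<otimes> z) \<le> \<delta>" using 0 delta_nonneg by (auto simp: min_def split: if_splits)
    have "ldist ?x (t \<otimes> z) \<le> ldist ?x z + B" using ldist_triangle[of ?x z "t \<otimes> z"] c t z by simp
    then have "gp ?x z (t \<otimes> z) > 2 * \<delta>" using d2 far t c z delta_nonneg B0 ldist_commute[of z ?x] ldist_commute[of "t \<otimes> z" ?x]
      by (simp add: gromov_product_def)
    moreover have "min (gp ?x \<one> z) (gp ?x z (t \<otimes> z)) - \<delta> \<le> gp ?x \<one> (t \<otimes> z)"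
      using c t z by (intro gp_hyp) auto
    ultimately show ?thesis using 1 delta_nonneg by (auto simp: min_def split: if_splits)
  qed
  have na: "gp a \<one> z \<le> 2 * \<delta>" using near[of g] g lg gz by (simp add: a_def)
  have nb: "gp b \<one> z \<le> 2 * \<delta>" using near[of "inv g"] g lg igz ca by (simp add: b_def len_inv)
  have nm: "gp m \<one> z \<le> 2 * \<delta>" using gpm delta_nonneg by simp
  have dab: "ldist m a = ldist b m" using ldist_left[of g b m] g m ca by (simp add: a_def b_def m_assoc[symmetric])
  have ga: "ldist (inv g) m = ldist \<one> a" using ldist_left[of g "inv g" m] g m by (simp add: a_def)
  have gb: "ldist (inv g) b = ldist \<one> m" using ldist_left[of "inv g" \<one> m] g m by (simp add: b_def)
  define t where "t = ldist \<one> m"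
  define ta where "ta = ldist \<one> a"
  define tb where "tb = ldist \<one> b"
  have ma: "ldist m a \<le> 6 * \<delta> + \<bar>t - ta\<bar>"
    using near_geodesic_close[of \<one> z m a "2 * \<delta>" "\<bar>t - ta\<bar>"] nm na m z ca by (simp add: t_def ta_def)
  have mb: "ldist m b \<le> 6 * \<delta> + \<bar>t - tb\<bar>"
    using near_geodesic_close[of \<one> z m b "2 * \<delta>" "\<bar>t - tb\<bar>"] nm nb m z ca by (simp add: t_def tb_def)
  have tb: "\<bar>t - tb\<bar> \<le> B"
    using ldist_triangle[of \<one> "inv g" b] ldist_triangle[of "inv g" \<one> b] gb g ca lg
    by (simp add: t_def tb_def len_inv)
  \<comment> \<open>The shift of a point \<open>x\<close> by \<open>g\<close> is the difference of its distances from \<open>inv g\<close> and from \<open>\<one>\<close>.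
    These two points are so close to each other that the four-point condition makes the difference
    the same for \<open>x = m\<close> and \<open>x = b\<close>.\<close>
  have S: "\<bar>ta + tb - 2 * t\<bar> \<le> 2 * \<delta>"
  proof -
    have "ldist \<one> m + ldist (inv g) b \<le> max (ldist \<one> (inv g) + ldist m b) (ldist \<one> b + ldist m (inv g)) + 2 * \<delta>"
      using ca m by (intro four_point) auto
    moreover have "ldist \<one> b + ldist (inv g) m \<le> max (ldist \<one> (inv g) + ldist b m) (ldist \<one> m + ldist b (inv g)) + 2 * \<delta>"
      using ca m by (intro four_point) auto
    moreover have "ldist \<one> (inv g) \<le> B" using g lg by (simp add: len_inv)
    ultimately show ?thesis
      using ga gb mb tb far ldist_commute[of m "inv g"] ldist_commute[of b "inv g"] ldist_commute[of m b] ca m delta_nonneg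
      unfolding t_def[symmetric] ta_def[symmetric] tb_def[symmetric] by (auto simp: max_def split: if_splits)
  qed
  have "\<bar>ta - tb\<bar> \<le> ldist b a"
    using ldist_triangle[of \<one> b a] ldist_triangle[of \<one> a b] ldist_commute[of a b] ca by (simp add: ta_def tb_def abs_le_iff)
  moreover have "2 * gp m b a = 2 * ldist m a - ldist b a"
    using dab ldist_commute[of m a] m ca by (simp add: gromov_product_def)
  ultimately show ?thesis using S ma by (simp add: a_def[symmetric] b_def[symmetric])
qed

text \<open>
  This excludes parabolic behaviour and uses that the group acts transitively on itself. If the
  midpoint \<open>m\<close> of a long segment from \<open>\<one>\<close> to \<open>h\<^sup>n\<close> were moved by at most \<open>R\<close> by too many of the powers
  \<open>h\<^sup>i\<close>, then the distinct elements \<open>inv m \<otimes> h\<^sup>i \<otimes> m\<close> would not fit into the ball of radius \<open>R\<close>. The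
  exponent \<open>n\<close> is chosen after the finitely many \<open>i\<close>, so that each of these powers moves the ends of
  the segment by little compared with its length.
\<close>

lemma exists_long_translation:
  assumes h: "h \<in> carrier G" and inf: "\<And>i j::nat. h [^] i = h [^] j \<Longrightarrow> i = j"
  shows "\<exists>i m. 0 < (i::nat) \<and> m \<in> carrier G \<and> R < ldist m (h [^] i \<otimes> m)
            \<and> gp m (inv (h [^] i) \<otimes> m) (h [^] i \<otimes> m) \<le> 7 * \<delta>"
proof -
  define M where "M = Suc (card {x \<in> carrier G. len x \<le> R})"
  define B where "B = (\<Sum>i\<le>M. len (h [^] i))"
  have B: "len (h [^] i) \<le> B" if "i \<le> M" for i
    unfolding B_def using that h by (intro member_le_sum) (auto simp: len_nonneg)
  have "infinite (range (\<lambda>n::nat. h [^] n))"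
    using inf by (intro range_inj_infinite) (auto simp: inj_def)
  then have "\<not> range (\<lambda>n::nat. h [^] n) \<subseteq> {x \<in> carrier G. len x \<le> 4 * B + 16 * \<delta> + 4}"
    using finite_ball finite_subset by blast
  then obtain n :: nat where n: "len (h [^] n) > 4 * B + 16 * \<delta> + 4"
    using h by (auto simp: subset_iff not_le)
  define z where "z = h [^] n"
  have z: "z \<in> carrier G" using h by (simp add: z_def)
  obtain m where m: "m \<in> carrier G" "len m + len (inv m \<otimes> z) = len z" "\<bar>len m - len (inv m \<otimes> z)\<bar> \<le> 1"
    using midpoint[OF z] by blast
  have lz: "len z > 4 * B + 16 * \<delta> + 4" using n by (simp add: z_def)
  have "\<exists>i. 0 < i \<and> i \<le> M \<and> ldist m (h [^] i \<otimes> m) > R"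
  proof (rule ccontr)
    assume "\<not> ?thesis"
    then have small: "ldist m (h [^] i \<otimes> m) \<le> R" if "0 < i" "i \<le> M" for i using that by force
    have "inj_on (\<lambda>i. inv m \<otimes> (h [^] i \<otimes> m)) {1..M}"
      using h m inf by (auto simp: inj_on_def)
    moreover have "(\<lambda>i. inv m \<otimes> (h [^] i \<otimes> m)) ` {1..M} \<subseteq> {x \<in> carrier G. len x \<le> R}"
      using small h m by (auto simp: ldist_def)
    ultimately have "card {1..M} \<le> card {x \<in> carrier G. len x \<le> R}"
      using finite_ball card_inj_on_le by blast
    then show False by (simp add: M_def)
  qed
  then obtain i where i: "0 < i" "i \<le> M" "ldist m (h [^] i \<otimes> m) > R" by blast
  have "ldist z (h [^] i \<otimes> z) = len (h [^] i)"
    using ldist_right[of z "h [^] i"] h z by (simp add: z_def nat_pow_mult add.commute)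
  then have "gp m (inv (h [^] i) \<otimes> m) (h [^] i \<otimes> m) \<le> 7 * \<delta>"
    using translation_along_segment[of "h [^] i" m z B] h m z B[OF i(2)] lz by (simp add: ldist_def len_inv)
  then show ?thesis using i m by blast
qed

text \<open>
  The powers of \<open>h\<close> run along a quasi-geodesic line in their natural order. No growth rate is part
  of the definition; that the powers of an \<open>h\<close> of infinite order leave every ball follows from the
  finiteness of balls.
\<close>

definition quasi_axis :: "'a \<Rightarrow> real \<Rightarrow> bool" where
  "quasi_axis h C \<longleftrightarrow> (\<forall>a b c::int. a \<le> b \<and> b \<le> c \<longrightarrow> gp (h [^] b) (h [^] a) (h [^] c) \<le> C)"

text \<open>
  Some power \<open>g\<close> of \<open>h\<close> moves a point \<open>m\<close> far and without turning back, so the local-to-global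
  principle applies to its conjugate \<open>f\<close> that moves \<open>\<one>\<close> instead of \<open>m\<close>. Conjugating back and
  interpolating between the powers of \<open>g\<close> changes the Gromov products by a bounded amount only.
\<close>

lemma quasi_axis_exists:
  assumes h: "h \<in> carrier G" and inf: "\<And>i j::nat. h [^] i = h [^] j \<Longrightarrow> i = j"
  shows "\<exists>C. quasi_axis h C"
proof -
  \<comment> \<open>With backtracking \<open>c = 7 * \<delta>\<close>, the two-sided chain of powers needs sides longer than
    \<open>2 * c + 3 * \<delta> = 17 * \<delta>\<close>.\<close>
  obtain i :: nat and m where i: "0 < i" and m: "m \<in> carrier G" and
    far: "17 * \<delta> < ldist m (h [^] i \<otimes> m)" and
    g7: "gp m (inv (h [^] i) \<otimes> m) (h [^] i \<otimes> m) \<le> 7 * \<delta>"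
    using exists_long_translation[OF h inf, of "17 * \<delta>"] by blast
  define g where "g = h [^] i"
  have g: "g \<in> carrier G" using h by (simp add: g_def)
  define f where "f = inv m \<otimes> g \<otimes> m"
  have f: "f \<in> carrier G" using g m by (simp add: f_def)
  have fi: "inv f = inv m \<otimes> (inv g \<otimes> m)" using g m by (simp add: f_def inv_mult_group m_assoc)
  have "len f > 17 * \<delta>" using far g m by (simp add: ldist_def f_def g_def m_assoc)
  moreover have "gp \<one> (inv f) f \<le> 7 * \<delta>"
    using g7 gp_left[of "inv m" m "inv g \<otimes> m" "g \<otimes> m"] g m fi by (simp add: g_def[symmetric] f_def m_assoc)
  ultimately have F: "gp \<one> (inv f [^] (k::nat)) (f [^] (l::nat)) \<le> 9 * \<delta>" for k l
    using chain_power_two_sided[of "7 * \<delta>" "len f" f k l] f delta_nonneg by simp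
  have conj: "m \<otimes> f [^] (k::nat) = g [^] k \<otimes> m" for k
  proof (induction k)
    case (Suc k)
    have "m \<otimes> f [^] Suc k = (m \<otimes> f [^] k) \<otimes> f" using f m by (simp add: m_assoc)
    also have "\<dots> = (g [^] k \<otimes> m) \<otimes> f" by (simp only: Suc)
    also have "\<dots> = g [^] k \<otimes> (m \<otimes> f)" using f g m by (simp add: m_assoc)
    also have "m \<otimes> f = g \<otimes> m" using g m by (simp add: f_def m_assoc[symmetric])
    also have "g [^] k \<otimes> (g \<otimes> m) = g [^] Suc k \<otimes> m" using g m by (simp add: m_assoc)
    finally show ?case .
  qed (use m in auto)
  have conji: "m \<otimes> inv f [^] (k::nat) = inv g [^] k \<otimes> m" for k
  proof (induction k)
    case (Suc k)
    have "m \<otimes> inv f [^] Suc k = (m \<otimes> inv f [^] k) \<otimes> inv f" using f m by (simp add: m_assoc)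
    also have "\<dots> = (inv g [^] k \<otimes> m) \<otimes> inv f" by (simp only: Suc)
    also have "\<dots> = inv g [^] k \<otimes> (m \<otimes> inv f)" using f g m by (simp add: m_assoc)
    also have "m \<otimes> inv f = inv g \<otimes> m" using g m by (simp add: fi m_assoc[symmetric])
    also have "inv g [^] k \<otimes> (inv g \<otimes> m) = inv g [^] Suc k \<otimes> m" using g m by (simp add: m_assoc)
    finally show ?case .
  qed (use m in auto)
  have g1: "gp \<one> (inv g [^] (k::nat)) (g [^] (l::nat)) \<le> 9 * \<delta> + 3 * len m" for k l
  proof -
    let ?x = "inv g [^] k" and ?y = "g [^] l"
    have c: "?x \<in> carrier G" "?y \<in> carrier G" using g by auto
    have "gp \<one> ?x ?y \<le> gp m ?x ?y + ldist \<one> m" using c m by (intro gp_move_base) auto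
    also have "gp m ?x ?y \<le> gp m ?x (?y \<otimes> m) + ldist ?y (?y \<otimes> m)" using c m by (intro gp_move_right) auto
    also have "gp m ?x (?y \<otimes> m) = gp m (?y \<otimes> m) ?x" using c m by (intro gp_commute) auto
    also have "\<dots> \<le> gp m (?y \<otimes> m) (?x \<otimes> m) + ldist ?x (?x \<otimes> m)" using c m by (intro gp_move_right) auto
    also have "gp m (?y \<otimes> m) (?x \<otimes> m) = gp m (?x \<otimes> m) (?y \<otimes> m)" using c m by (intro gp_commute) auto
    also have "\<dots> = gp \<one> (inv f [^] k) (f [^] l)"
      using gp_left[of m \<one> "inv f [^] k" "f [^] l"] f m conj conji by simp
    finally show ?thesis using F[of k l] ldist_right[of ?y m] ldist_right[of ?x m] c m by simp
  qed
  define B where "B = (\<Sum>r<i. len (h [^] r))"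
  have B: "len (h [^] r) \<le> B" if "r < i" for r
    unfolding B_def using that h by (intro member_le_sum) (auto simp: len_nonneg)
  have h1: "gp \<one> (inv h [^] (k::nat)) (h [^] (l::nat)) \<le> 9 * \<delta> + 3 * len m + 2 * B" for k l
  proof -
    have dec: "x [^] (k::nat) = (x [^] i) [^] (k div i) \<otimes> x [^] (k mod i)" if "x \<in> carrier G" for x k
      using that by (simp add: nat_pow_pow nat_pow_mult)
    let ?x = "inv g [^] (k div i)" and ?y = "g [^] (l div i)"
    let ?x' = "inv h [^] k" and ?y' = "h [^] l"
    have c: "?x \<in> carrier G" "?y \<in> carrier G" "?x' \<in> carrier G" "?y' \<in> carrier G" using g h by auto
    have "ldist ?y ?y' = len (h [^] (l mod i))"
      unfolding dec[OF h, of l] g_def using h by (simp add: ldist_right)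
    then have dy: "ldist ?y' ?y \<le> B" using B[of "l mod i"] i c ldist_commute by simp
    have "inv (h [^] i) = inv h [^] i" using h by (simp add: nat_pow_inv)
    then have "ldist ?x ?x' = len (inv h [^] (k mod i))"
      using dec[of "inv h" k] h by (simp add: g_def ldist_right)
    then have dx: "ldist ?x' ?x \<le> B" using B[of "k mod i"] i c ldist_commute h by (simp add: nat_pow_inv len_inv)
    have "gp \<one> ?x' ?y' \<le> gp \<one> ?x' ?y + ldist ?y' ?y" using c by (intro gp_move_right) auto
    also have "gp \<one> ?x' ?y = gp \<one> ?y ?x'" using c by (intro gp_commute) auto
    also have "\<dots> \<le> gp \<one> ?y ?x + ldist ?x' ?x" using c by (intro gp_move_right) auto
    also have "gp \<one> ?y ?x = gp \<one> ?x ?y" using c by (intro gp_commute) auto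
    finally show ?thesis using g1[of "k div i" "l div i"] dx dy by linarith
  qed
  have "quasi_axis h (9 * \<delta> + 3 * len m + 2 * B)"
    unfolding quasi_axis_def
  proof (intro allI impI)
    fix a b c :: int assume ab: "a \<le> b \<and> b \<le> c"
    have e: "h [^] a = h [^] b \<otimes> h [^] (a - b)" "h [^] c = h [^] b \<otimes> h [^] (c - b)"
      using h by (simp_all add: int_pow_mult[symmetric])
    have "gp (h [^] b) (h [^] a) (h [^] c) = gp (h [^] b \<otimes> \<one>) (h [^] b \<otimes> h [^] (a - b)) (h [^] b \<otimes> h [^] (c - b))"
      unfolding e[symmetric] using h by simp
    also have "\<dots> = gp \<one> (h [^] (a - b)) (h [^] (c - b))"
      using h by (intro gp_left) auto
    also have "h [^] (a - b) = inv h [^] nat (b - a)"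
    proof -
      have "h [^] (a - b) = h [^] (- int (nat (b - a)))" using ab by simp
      also have "\<dots> = inv h [^] nat (b - a)" using h by (simp only: int_pow_neg_int nat_pow_inv)
      finally show ?thesis .
    qed
    also have "h [^] (c - b) = h [^] nat (c - b)" using ab by (simp add: pow_nat)
    finally show "gp (h [^] b) (h [^] a) (h [^] c) \<le> 9 * \<delta> + 3 * len m + 2 * B" using h1 by simp
  qed
  then show ?thesis by blast
qed

end

section \<open>Commensurators of cyclic subgroups\<close>

text \<open>
  A discrete intermediate value theorem.
\<close>

lemma int_discrete_crossing:
  fixes f :: "int \<Rightarrow> real"
  assumes "b \<le> c" "f b \<le> t" "t \<le> f c" "\<And>i. \<bar>f (i + 1) - f i\<bar> \<le> K"
  shows "\<exists>a. b \<le> a \<and> a \<le> c \<and> \<bar>f a - t\<bar> \<le> K"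
  using assms(1,3)
proof (induction c rule: int_ge_induct)
  case base
  have "0 \<le> K" using assms(4)[of b] by linarith
  then show ?case using base assms(2) by (intro exI[of _ b]) auto
next
  case (step c)
  show ?case
  proof (cases "t \<le> f c")
    case True
    then show ?thesis using step by fastforce
  next
    case False
    then show ?thesis using step assms(4)[of c] by (intro exI[of _ c]) (auto simp: abs_le_iff)
  qed
qed

lemma (in group) intertwine_int_pow:
  assumes "d \<in> carrier G" "x \<in> carrier G" "y \<in> carrier G" "d \<otimes> x = y \<otimes> d"
  shows "d \<otimes> x [^] (n::int) = y [^] n \<otimes> d"
proof -
  have y: "y = d \<otimes> x \<otimes> inv d" using assms by (simp add: m_assoc)
  have N: "d \<otimes> x [^] (k::nat) = y [^] k \<otimes> d" for k
  proof (induction k)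
    case (Suc k)
    have "d \<otimes> x [^] Suc k = (d \<otimes> x [^] k) \<otimes> x" using assms by (simp add: m_assoc)
    also have "\<dots> = y [^] k \<otimes> (d \<otimes> x)" using assms Suc by (simp add: m_assoc)
    also have "\<dots> = y [^] Suc k \<otimes> d" using assms by (simp add: m_assoc)
    finally show ?case .
  qed (use assms in auto)
  show ?thesis
  proof (cases n rule: int_cases2)
    case (nonneg k)
    then show ?thesis using N[of k] by (simp add: int_pow_int)
  next
    case (nonpos k)
    have "inv (y [^] k) \<otimes> d = inv (y [^] k) \<otimes> (d \<otimes> x [^] k) \<otimes> inv (x [^] k)" using assms by (simp add: m_assoc)
    also have "\<dots> = d \<otimes> inv (x [^] k)" unfolding N using assms by (simp add: m_assoc[symmetric])
    finally have "d \<otimes> inv (x [^] k) = inv (y [^] k) \<otimes> d" by simp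
    then show ?thesis using nonpos assms by (simp add: int_pow_neg_int)
  qed
qed

locale torsion_free_hyperbolic = hyperbolic_length G len \<delta> for G (structure) and len and \<delta> +
  assumes torsion_free: "torsion_free G"
begin

lemma int_pow_inject:
  assumes h: "h \<in> carrier G" "h \<noteq> \<one>" and eq: "h [^] (p::int) = h [^] (q::int)"
  shows "p = q"
proof (rule ccontr)
  assume "p \<noteq> q"
  have "\<exists>n::nat. n > 0 \<and> h [^] n = \<one>"
  proof (cases "p < q")
    case True
    have "h [^] (q - p) = \<one>" using h eq by (simp add: int_pow_diff)
    then show ?thesis using True by (intro exI[of _ "nat (q - p)"]) (auto simp: pow_nat)
  next
    case False
    have "h [^] (p - q) = \<one>" using h eq by (simp add: int_pow_diff)
    then show ?thesis using False \<open>p \<noteq> q\<close> by (intro exI[of _ "nat (p - q)"]) (auto simp: pow_nat)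
  qed
  then show False using torsion_free h unfolding torsion_free_def by blast
qed

lemma int_pow_eq_one: "h \<in> carrier G \<Longrightarrow> h \<noteq> \<one> \<Longrightarrow> h [^] (p::int) = \<one> \<Longrightarrow> p = 0"
  using int_pow_inject[of h p 0] by simp

lemma finite_short_powers: assumes "h \<in> carrier G" "h \<noteq> \<one>"
  shows "finite {n::int. len (h [^] n) \<le> T}"
proof -
  have "inj_on (\<lambda>n::int. h [^] n) UNIV" using int_pow_inject[OF assms] by (auto simp: inj_on_def)
  moreover have "finite ((\<lambda>n::int. h [^] n) ` {n. len (h [^] n) \<le> T})"
    using assms by (intro finite_subset[OF _ finite_ball[of T]]) auto
  ultimately show ?thesis using finite_imageD inj_on_subset by blast
qed

lemma quasi_axisE: assumes "h \<in> carrier G" "h \<noteq> \<one>" obtains C where "quasi_axis h C"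
proof -
  have "i = j" if "h [^] i = h [^] j" for i j :: nat
    using int_pow_inject[OF assms, of "int i" "int j"] that by (simp add: int_pow_int)
  then show thesis using quasi_axis_exists[OF assms(1)] that by blast
qed

lemma quasi_axisD:
  assumes "quasi_axis h C" "h \<in> carrier G" "a \<le> b \<and> b \<le> c \<or> c \<le> b \<and> b \<le> (a::int)"
  shows "gp (h [^] b) (h [^] a) (h [^] c) \<le> C"
proof (cases "a \<le> b \<and> b \<le> c")
  case True
  then show ?thesis using assms(1) unfolding quasi_axis_def by blast
next
  case False
  then have "gp (h [^] b) (h [^] c) (h [^] a) \<le> C" using assms(1,3) unfolding quasi_axis_def by blast
  then show ?thesis using gp_commute[of "h [^] a" "h [^] c"] assms(2) by simp
qed

text \<open>
  From one power of \<open>h\<close> to the next, the distance from \<open>h\<^sup>b\<close> changes by at most \<open>len h\<close>. So some power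
  between \<open>h\<^sup>b\<close> and \<open>h\<^sup>c\<close> is about as far from \<open>h\<^sup>b\<close> as \<open>x\<close> is, and as both lie near the geodesics from
  \<open>h\<^sup>b\<close> to \<open>h\<^sup>c\<close>, they are close.
\<close>

lemma near_quasi_axis:
  assumes h: "h \<in> carrier G" "quasi_axis h C" and x: "x \<in> carrier G"
    and g: "gp x (h [^] (b::int)) (h [^] (c::int)) \<le> C'" and C': "C \<le> C'"
  shows "\<exists>a::int. ldist x (h [^] a) \<le> 4 * C' + len h + 2 * \<delta>"
proof -
  have *: ?thesis if bc: "b \<le> c" and g: "gp x (h [^] b) (h [^] c) \<le> C'" for b c :: int
  proof -
    let ?p = "h [^] b" and ?q = "h [^] c"
    have pq: "?p \<in> carrier G" "?q \<in> carrier G" using h by auto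
    define t where "t = min (ldist ?p x) (ldist ?p ?q)"
    have C'0: "0 \<le> C'" using gp_nonneg[of x ?p ?q] g x pq by linarith
    have "ldist ?p x \<le> ldist ?p ?q + 2 * C'"
      using g ldist_nonneg[of ?q x] pq x unfolding gromov_product_def by (simp add: field_simps)
    then have tx: "\<bar>t - ldist ?p x\<bar> \<le> 2 * C'" using C'0 by (auto simp: t_def min_def)
    have "\<exists>a. b \<le> a \<and> a \<le> c \<and> \<bar>ldist ?p (h [^] a) - t\<bar> \<le> len h"
    proof (rule int_discrete_crossing[OF bc])
      show "ldist ?p (h [^] b) \<le> t" using pq x by (simp add: t_def ldist_nonneg)
      show "t \<le> ldist ?p ?q" by (simp add: t_def)
      show "\<bar>ldist ?p (h [^] (i + 1)) - ldist ?p (h [^] i)\<bar> \<le> len h" for i :: int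
      proof -
        have "ldist (h [^] i) (h [^] (i + 1)) = len h"
          using int_pow_mult[of h i 1] ldist_right[of "h [^] i" h] h by simp
        then show ?thesis
          using ldist_triangle[of ?p "h [^] i" "h [^] (i+1)"] ldist_triangle[of ?p "h [^] (i+1)" "h [^] i"]
            ldist_commute[of "h [^] i" "h [^] (i+1)"] h by (simp add: abs_le_iff)
      qed
    qed
    then obtain a where a: "b \<le> a" "a \<le> c" "\<bar>ldist ?p (h [^] a) - t\<bar> \<le> len h" by blast
    have "gp (h [^] a) ?p ?q \<le> C'" using quasi_axisD[OF h(2,1), of b a c] a C' by simp
    then have "ldist x (h [^] a) \<le> 2 * C' + (2 * C' + len h) + 2 * \<delta>"
      using g a tx x h by (intro near_geodesic_close[of ?p ?q]) auto
    then show ?thesis by (intro exI[of _ a]) simp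
  qed
  show ?thesis
  proof (cases "b \<le> c")
    case True
    then show ?thesis using * g by blast
  next
    case False
    then show ?thesis using *[of c b] g h gp_commute[of "h [^] b" "h [^] c" x] by simp
  qed
qed

text \<open>
  Membership of \<open>d\<close> in the commensurator of the cyclic group generated by \<open>h\<close>.
\<close>

definition commensurates :: "'a \<Rightarrow> 'a \<Rightarrow> bool" where
  "commensurates d h \<longleftrightarrow> (\<exists>(p::int) (q::int). p \<noteq> 0 \<and> q \<noteq> 0 \<and> d \<otimes> h [^] p = h [^] q \<otimes> d)"

lemma commensurates_one: "h \<in> carrier G \<Longrightarrow> commensurates \<one> h"
  unfolding commensurates_def by (intro exI[of _ 1]) simp

lemma commensurates_mult:
  assumes c: "x \<in> carrier G" "y \<in> carrier G" "h \<in> carrier G" and "commensurates x h" "commensurates y h"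
  shows "commensurates (x \<otimes> y) h"
proof -
  obtain p q p' q' :: int where 1: "p \<noteq> 0" "q \<noteq> 0" "x \<otimes> h [^] p = h [^] q \<otimes> x"
    and 2: "p' \<noteq> 0" "q' \<noteq> 0" "y \<otimes> h [^] p' = h [^] q' \<otimes> y"
    using assms(4,5) unfolding commensurates_def by blast
  have "(x \<otimes> y) \<otimes> h [^] (p' * p) = x \<otimes> (y \<otimes> (h [^] p') [^] p)"
    using c by (simp add: m_assoc int_pow_pow)
  also have "\<dots> = x \<otimes> ((h [^] q') [^] p \<otimes> y)"
    using c 2 intertwine_int_pow[of y "h [^] p'" "h [^] q'" p] by simp
  also have "\<dots> = (x \<otimes> (h [^] p) [^] q') \<otimes> y" using c by (simp add: m_assoc int_pow_pow mult.commute)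
  also have "\<dots> = ((h [^] q) [^] q' \<otimes> x) \<otimes> y"
    using c 1 intertwine_int_pow[of x "h [^] p" "h [^] q" q'] by simp
  also have "\<dots> = h [^] (q * q') \<otimes> (x \<otimes> y)" using c by (simp add: m_assoc int_pow_pow)
  finally show ?thesis unfolding commensurates_def using 1 2 by (intro exI[of _ "p' * p"] exI[of _ "q * q'"]) simp
qed

text \<open>
  The line of the points \<open>d \<otimes> h\<^sup>n\<close> and the axis of \<open>h\<close> have the same two ends, since
  \<open>d \<otimes> h\<^sup>p\<^sup>r = h\<^sup>q\<^sup>r \<otimes> d\<close> is at distance \<open>len d\<close> from \<open>h\<^sup>q\<^sup>r\<close> for every \<open>r\<close>. As \<open>d\<close> is a point of the first
  line, it is near the second one. The point of the lemma is that \<open>K\<close> depends on \<open>h\<close> only.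
\<close>

lemma commensurator_near_axis:
  assumes h: "h \<in> carrier G" "h \<noteq> \<one>"
  shows "\<exists>K. \<forall>d\<in>carrier G. commensurates d h \<longrightarrow> (\<exists>j::int. ldist d (h [^] j) \<le> K)"
proof -
  obtain C where C: "quasi_axis h C" using quasi_axisE[OF h] by blast
  have "\<exists>j::int. ldist d (h [^] j) \<le> 4 * (C + 2 * \<delta>) + len h + 2 * \<delta>"
    if d: "d \<in> carrier G" and dh: "commensurates d h" for d
  proof -
    obtain p q :: int where pq: "p \<noteq> 0" "q \<noteq> 0" "d \<otimes> h [^] p = h [^] q \<otimes> d"
      using dh unfolding commensurates_def by blast
    \<comment> \<open>The ends of the segment have to be so far away that moving them by \<open>len d\<close> is not visible from
      \<open>d\<close>.\<close>
    let ?T = "2 * len d + C + 2 * \<delta>"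
    have "finite ((\<lambda>r. q * r) -` {n::int. len (h [^] n) \<le> ?T})"
      using pq by (intro finite_vimageI finite_short_powers[OF h]) (auto simp: inj_def)
    then have "(\<lambda>r. q * r) -` {n::int. len (h [^] n) \<le> ?T} \<noteq> UNIV" using infinite_UNIV_int by auto
    then obtain r where "r \<notin> (\<lambda>r. q * r) -` {n::int. len (h [^] n) \<le> ?T}" by blast
    then have r: "len (h [^] (q * r)) > ?T" by (simp add: not_le)
    have tr: "d \<otimes> h [^] (p * s) = h [^] (q * s) \<otimes> d" for s
      using intertwine_int_pow[OF d _ _ pq(3), of s] h by (simp add: int_pow_pow)
    define x where "x = h [^] (q * r)"
    define y where "y = h [^] (q * (- r))"
    have c: "x \<in> carrier G" "y \<in> carrier G" using h by (auto simp: x_def y_def)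
    have lx: "len x > ?T" and ly: "len y > ?T" using r h by (auto simp: x_def y_def int_pow_neg len_inv)
    have *: "gp d (z \<otimes> d) z > C + 2 * \<delta>" if z: "z \<in> carrier G" "len z > ?T" for z
    proof -
      have "ldist z (z \<otimes> d) = len d" using z d by (simp add: ldist_right)
      moreover have "len z \<le> ldist z d + len d" using ldist_triangle[of z d \<one>] z d by simp
      moreover have "ldist z d \<le> ldist z (z \<otimes> d) + ldist (z \<otimes> d) d" using z d by (intro ldist_triangle) auto
      ultimately show ?thesis using z d ldist_commute[of z "z \<otimes> d"] delta_nonneg by (simp add: gromov_product_def field_simps)
    qed
    have "gp d (x \<otimes> d) (y \<otimes> d) = gp (d \<otimes> \<one>) (d \<otimes> h [^] (p * r)) (d \<otimes> h [^] (p * (- r)))"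
      unfolding tr x_def y_def using d by simp
    also have "\<dots> = gp (h [^] (0::int)) (h [^] (p * r)) (h [^] (p * (- r)))" 
      using gp_left[of d \<one> "h [^] (p * r)" "h [^] (p * (- r))"] d h by simp
    also have "\<dots> \<le> C" by (rule quasi_axisD[OF C h(1)]) (auto simp: zero_le_mult_iff mult_le_0_iff)
    finally have 1: "gp d (x \<otimes> d) (y \<otimes> d) \<le> C" .
    have "min (gp d (x \<otimes> d) x) (gp d x (y \<otimes> d)) - \<delta> \<le> gp d (x \<otimes> d) (y \<otimes> d)"
      using d c by (intro gp_hyp) auto
    then have 2: "gp d x (y \<otimes> d) \<le> C + \<delta>" using *[OF c(1) lx] 1 delta_nonneg by linarith
    have "min (gp d x y) (gp d y (y \<otimes> d)) - \<delta> \<le> gp d x (y \<otimes> d)"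
      using d c by (intro gp_hyp) auto
    moreover have "gp d y (y \<otimes> d) = gp d (y \<otimes> d) y" using c d by (intro gp_commute) auto
    ultimately have "gp d x y \<le> C + 2 * \<delta>" using *[OF c(2) ly] 2 delta_nonneg by linarith
    then show ?thesis using near_quasi_axis[OF h(1) C d, of "q * r" "q * (- r)" "C + 2 * \<delta>"] delta_nonneg
      by (simp add: x_def y_def)
  qed
  then show ?thesis by blast
qed

text \<open>
  The powers of \<open>d\<close> commensurate \<open>h\<close> as well, so all of them are within the same distance \<open>K\<close> of a power
  of \<open>h\<close>. By the finiteness of balls two of the errors \<open>inv (d [^] i) \<otimes> h [^] J i\<close> coincide.
\<close>

lemma commensurates_common_power:
  assumes h: "h \<in> carrier G" "h \<noteq> \<one>" and d: "d \<in> carrier G" "d \<noteq> \<one>" and dh: "commensurates d h"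
  shows "\<exists>(m::int) (n::int). m \<noteq> 0 \<and> n \<noteq> 0 \<and> d [^] m = h [^] n"
proof -
  obtain K where K: "\<And>d. d \<in> carrier G \<Longrightarrow> commensurates d h \<Longrightarrow> \<exists>j::int. ldist d (h [^] j) \<le> K"
    using commensurator_near_axis[OF h] by blast
  have "commensurates (d [^] (i::nat)) h" for i
    by (induction i) (use h d dh commensurates_one commensurates_mult in auto)
  then have "\<exists>j::int. ldist (d [^] (i::nat)) (h [^] j) \<le> K" for i using K d by simp
  then obtain J :: "nat \<Rightarrow> int" where J: "\<And>i::nat. ldist (d [^] i) (h [^] J i) \<le> K" by metis
  have "(\<lambda>i. inv (d [^] i) \<otimes> h [^] J i) ` UNIV \<subseteq> {x \<in> carrier G. len x \<le> K}"
    using J d h by (auto simp: ldist_def)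
  then have "finite ((\<lambda>i. inv (d [^] i) \<otimes> h [^] J i) ` UNIV)" using finite_ball finite_subset by blast
  then have "\<not> inj (\<lambda>i. inv (d [^] i) \<otimes> h [^] J i)" using finite_imageD by blast
  then obtain i i' where ne: "i \<noteq> i'" and eq: "inv (d [^] i) \<otimes> h [^] J i = inv (d [^] i') \<otimes> h [^] J i'"
    by (auto simp: inj_def)
  have "d [^] (int i' - int i) = d [^] i' \<otimes> inv (d [^] i)" using d by (simp add: int_pow_diff int_pow_int)
  also have "\<dots> = h [^] J i' \<otimes> inv (h [^] J i)"
  proof -
    have "d [^] i' \<otimes> (inv (d [^] i) \<otimes> h [^] J i) = h [^] J i'"
      unfolding eq using d h by (simp add: m_assoc[symmetric])
    then show ?thesis using d h by (simp add: inv_solve_right m_assoc)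
  qed
  also have "\<dots> = h [^] (J i' - J i)" using h by (simp add: int_pow_diff)
  finally have e: "d [^] (int i' - int i) = h [^] (J i' - J i)" .
  moreover have "int i' - int i \<noteq> 0" using ne by simp
  moreover from this have "J i' - J i \<noteq> 0" using e int_pow_eq_one[OF d, of "int i' - int i"] by auto
  ultimately show ?thesis by blast
qed

text \<open>
  If the translate by \<open>d\<close> of the axis of \<open>h\<close> runs along the axis itself for a very long time, then
  all of the points \<open>d \<otimes> h\<^sup>i\<close> with \<open>\<bar>i\<bar> \<le> M\<close> on one side are within a distance \<open>K\<close> of powers \<open>h [^] J i\<close>,
  where \<open>M\<close> is the number of elements in the ball of radius \<open>K\<close>. Two of the errors coincide, and this
  is a relation that commensurates \<open>h\<close>. The side, positive or negative powers, is the sign \<open>s\<close> of \<open>n\<close>.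
\<close>

lemma bounded_overlap_or_commensurates:
  assumes h: "h \<in> carrier G" "h \<noteq> \<one>" and d: "d \<in> carrier G" and nc: "\<not> commensurates d h"
  shows "\<exists>T. \<forall>(n::int) (k::int). gp \<one> (d \<otimes> h [^] n) (h [^] k) \<le> T"
proof -
  obtain C where C: "quasi_axis h C" using quasi_axisE[OF h] by blast
  have C0: "0 \<le> C" using quasi_axisD[OF C h(1), of 0 0 0] by (simp add: gromov_product_def len_one)
  define C1 where "C1 = C + len d + \<delta>"
  have C1: "C \<le> C1" "0 \<le> C1" using C0 len_nonneg[OF d] delta_nonneg by (auto simp: C1_def)
  define K where "K = 4 * C1 + len h + 2 * \<delta>"
  define M where "M = int (card {x \<in> carrier G. len x \<le> K})"
  define B where "B = (\<Sum>i\<in>{-M..M}. len (d \<otimes> h [^] i))"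
  have B: "len (d \<otimes> h [^] i) \<le> B" if "i \<in> {-M..M}" for i
    unfolding B_def using that h d by (intro member_le_sum) (auto intro!: len_nonneg)
  have "gp \<one> (d \<otimes> h [^] n) (h [^] k) \<le> B + C1 + \<delta>" for n k :: int
  proof (rule ccontr)
    assume "\<not> ?thesis"
    then have big: "gp \<one> (d \<otimes> h [^] n) (h [^] k) > B + C1 + \<delta>" by simp
    have nM: "n \<notin> {-M..M}"
      using gp_le[of \<one> "d \<otimes> h [^] n" "h [^] k"] B[of n] big h d C1 delta_nonneg by auto
    define s where "s = sgn n"
    have s: "s * s = 1" "s \<noteq> 0" using nM by (auto simp: s_def sgn_if M_def split: if_splits)
    have close: "\<exists>j::int. ldist (d \<otimes> h [^] (s * i)) (h [^] j) \<le> K" if i: "i \<in> {0..M}" for i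
    proof -
      define x where "x = d \<otimes> h [^] (s * i)"
      define y where "y = d \<otimes> h [^] n"
      define z where "z = h [^] k"
      have c: "x \<in> carrier G" "y \<in> carrier G" "z \<in> carrier G" using h d by (auto simp: x_def y_def z_def)
      have "s * i \<in> {-M..M}" using i by (auto simp: s_def sgn_if)
      then have lx: "len x \<le> B" using B by (simp add: x_def)
      have "gp x d y = gp x (d \<otimes> h [^] (0::int)) y" using d by simp
      also have "\<dots> = gp (h [^] (s * i)) (h [^] (0::int)) (h [^] n)"
        unfolding x_def y_def using d h by (intro gp_left) auto
      also have "\<dots> \<le> C" using i nM by (intro quasi_axisD[OF C h(1)]) (auto simp: s_def sgn_if)
      finally have "gp x d y \<le> C" .
      moreover have "gp x y \<one> \<le> gp x y d + ldist \<one> d" using c d by (intro gp_move_right) auto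
      ultimately have 1: "gp x \<one> y \<le> C1 - \<delta>"
        using gp_commute[of d y x] gp_commute[of \<one> y x] c d by (simp add: C1_def)
      have "gp \<one> y z \<le> gp x y z + ldist \<one> x" using c by (intro gp_move_base) auto
      then have 2: "gp x z y > C1 + \<delta>" using big lx c gp_commute[of y z x] by (simp add: y_def z_def)
      have "min (gp x \<one> z) (gp x z y) - \<delta> \<le> gp x \<one> y" using c by (intro gp_hyp) auto
      then have "gp x (h [^] (0::int)) (h [^] k) \<le> C1" using 1 2 delta_nonneg by (simp add: z_def min_def split: if_splits)
      from near_quasi_axis[OF h(1) C c(1) this C1(1)] show ?thesis by (simp add: K_def x_def)
    qed
    then obtain J where J: "\<And>i. i \<in> {0..M} \<Longrightarrow> ldist (d \<otimes> h [^] (s * i)) (h [^] (J i :: int)) \<le> K" by metis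
    define F where "F i = inv (d \<otimes> h [^] (s * i)) \<otimes> h [^] J i" for i
    have "F ` {0..M} \<subseteq> {x \<in> carrier G. len x \<le> K}" using J h d by (auto simp: ldist_def F_def)
    then have "card (F ` {0..M}) \<le> card {x \<in> carrier G. len x \<le> K}" using finite_ball card_mono by blast
    then have "card (F ` {0..M}) < card {0..M}" by (simp add: M_def)
    then have "\<not> inj_on F {0..M}" using card_image by fastforce
    then obtain i i' where ne: "i \<noteq> i'" and eq: "F i = F i'" by (auto simp: inj_on_def)
    have c: "h [^] u \<in> carrier G" for u :: int using h by simp
    have "h [^] J i' = (d \<otimes> h [^] (s * i')) \<otimes> F i"
      unfolding eq unfolding F_def using d c by (simp add: m_assoc[symmetric])
    also have "\<dots> = d \<otimes> (h [^] (s * i') \<otimes> inv (h [^] (s * i))) \<otimes> inv d \<otimes> h [^] J i"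
      using d c by (simp add: F_def inv_mult_group m_assoc)
    finally have "h [^] J i' = d \<otimes> h [^] (s * i' - s * i) \<otimes> inv d \<otimes> h [^] J i" using h by (simp add: int_pow_diff)
    then have "h [^] J i' \<otimes> inv (h [^] J i) = d \<otimes> h [^] (s * i' - s * i) \<otimes> inv d"
      using d c by (simp add: m_assoc)
    then have e: "h [^] (J i' - J i) = d \<otimes> h [^] (s * i' - s * i) \<otimes> inv d" using h by (simp add: int_pow_diff)
    then have e': "d \<otimes> h [^] (s * i' - s * i) = h [^] (J i' - J i) \<otimes> d" using d c by (simp add: m_assoc)
    have u: "s * i' - s * i \<noteq> 0" using ne s by auto
    have "J i' - J i \<noteq> 0"
    proof
      assume "J i' - J i = 0"
      then have "d \<otimes> h [^] (s * i' - s * i) = d" using e' d by simp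
      then have "h [^] (s * i' - s * i) = \<one>" using d c by (metis l_cancel_one)
      then show False using int_pow_eq_one[OF h] u by blast
    qed
    then show False using nc e' u unfolding commensurates_def by blast
  qed
  then show ?thesis by blast
qed

text \<open>
  Otherwise every element of \<open>G\<close> is within a fixed distance of a power of \<open>h\<close>, so a ball meets all
  cosets of the cyclic group generated by \<open>h\<close>.
\<close>

lemma exists_not_commensurating:
  assumes h: "h \<in> carrier G" "h \<noteq> \<one>" and nvc: "\<not> virtually_cyclic G"
  shows "\<exists>g\<in>carrier G. \<not> commensurates g h"
proof (rule ccontr)
  assume "\<not> ?thesis"
  then obtain K where K: "\<And>d. d \<in> carrier G \<Longrightarrow> \<exists>j::int. ldist d (h [^] j) \<le> K"
    using commensurator_near_axis[OF h] by blast
  define H where "H = carrier (subgroup_generated G {h})"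
  have H: "subgroup H G" unfolding H_def
    by (simp add: subgroup_subgroup_generated)
  have "carrier (subgroup_generated G H) = H" using subgroup.carrier_subgroup_generated_subgroup[OF H] .
  then have "subgroup_generated G H = subgroup_generated G {h}"
    by (simp add: H_def subgroup_generated_def)
  then have cyc: "cyclic_group (subgroup_generated G H)" by (simp add: cyclic_group_generated)
  have pow: "h [^] j \<in> H" for j :: int
    using h carrier_subgroup_generated_by_singleton[of h] by (auto simp: H_def)
  have "rcosets H \<subseteq> (\<lambda>x. H #> x) ` {x \<in> carrier G. len x \<le> K}"
  proof
    fix c assume "c \<in> rcosets H"
    then obtain d where d: "d \<in> carrier G" "c = H #> d" by (auto simp: RCOSETS_def)
    obtain j :: int where j: "ldist d (h [^] j) \<le> K" using K d by blast
    define s where "s = inv (h [^] j) \<otimes> d"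
    have s: "s \<in> carrier G" using d h by (simp add: s_def)
    have "ldist (h [^] j) d \<le> K" using j ldist_commute[of d] d h by simp
    then have "len s \<le> K" by (simp add: s_def ldist_def)
    moreover have "H #> s = c"
    proof -
      have "inv (h [^] j) \<in> H" using pow[of "-j"] h by (simp add: int_pow_neg)
      then have "H #> inv (h [^] j) = H" using coset_join2[of "inv (h [^] j)" H] H h by simp
      then show ?thesis using coset_mult_assoc[of H "inv (h [^] j)" d] h d subgroup.subset[OF H] by (simp add: s_def)
    qed
    ultimately show "c \<in> (\<lambda>x. H #> x) ` {x \<in> carrier G. len x \<le> K}" using s by blast
  qed
  then have "finite (rcosets H)" using finite_ball finite_surj by blast
  then show False using nvc H cyc unfolding virtually_cyclic_def by blast
qed

text \<open>
  Let \<open>g\<close> not commensurate a nontrivial \<open>h \<in> H\<close>, and let \<open>k\<close> be the conjugate of \<open>h\<close> by \<open>g\<close>. No two of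
  the conjugates \<open>f i\<close> of \<open>h\<close> by powers \<open>k\<^sup>i\<close> have a nonzero power in common: otherwise a
  nonzero power of \<open>k\<close> commensurates \<open>h\<close>, so that \<open>k\<close> and \<open>h\<close> have a common power and \<open>g\<close>
  commensurates \<open>h\<close>. An element of \<open>D\<close> therefore commensurates at most one of the \<open>f i\<close>.
\<close>

lemma normal_subgroup_generic_element:
  assumes nvc: "\<not> virtually_cyclic G" and H: "H \<lhd> G" "H \<noteq> {\<one>}"
    and D: "finite D" "D \<subseteq> carrier G" "\<one> \<notin> D"
  shows "\<exists>h\<in>H. h \<noteq> \<one> \<and> (\<forall>d\<in>D. \<not> commensurates d h)"
proof -
  interpret H: normal H G by fact
  obtain h where hH: "h \<in> H" and h1: "h \<noteq> \<one>" using H(2) H.one_closed by blast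
  have h: "h \<in> carrier G" using hH by simp
  obtain g where g: "g \<in> carrier G" "\<not> commensurates g h" using exists_not_commensurating[OF h h1 nvc] by blast
  define k where "k = g \<otimes> h \<otimes> inv g"
  have kH: "k \<in> H" unfolding k_def using H.inv_op_closed2 g hH by simp
  have k: "k \<in> carrier G" using kH by simp
  have gk: "g \<otimes> h [^] n = k [^] n \<otimes> g" for n :: int
    using g h k by (intro intertwine_int_pow) (auto simp: k_def m_assoc)
  have k1: "k \<noteq> \<one>"
  proof
    assume "k = \<one>"
    then have "g \<otimes> h = g" using gk[of 1] g h by simp
    then show False using g h h1 by (metis l_cancel_one)
  qed
  define f where "f i = k [^] i \<otimes> h \<otimes> inv (k [^] i)" for i :: int
  have f: "f i \<in> carrier G" "f i \<in> H" for i
    using k h hH H.inv_op_closed2[of "k [^] i" h] by (auto simp: f_def)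
  have fk: "k [^] i \<otimes> h [^] n = f i [^] n \<otimes> k [^] i" for i n :: int
    using k h f by (intro intertwine_int_pow) (auto simp: f_def m_assoc)
  have f1: "f i \<noteq> \<one>" for i
  proof
    assume "f i = \<one>"
    then have "k [^] i \<otimes> h = k [^] i" using fk[of i 1] k h by simp
    then show False using k h h1 by (metis l_cancel_one int_pow_closed)
  qed
  have "\<exists>i. \<forall>d\<in>D. \<not> commensurates d (f i)"
  proof (rule ccontr)
    assume "\<not> ?thesis"
    then have "\<forall>i. \<exists>d. d \<in> D \<and> commensurates d (f i)" by blast
    from choice[OF this] obtain F where "\<forall>i. F i \<in> D \<and> commensurates (F i) (f i)" by blast
    then have F: "\<And>i. F i \<in> D" "\<And>i. commensurates (F i) (f i)" by auto
    have "finite (range F)" by (rule finite_subset[OF _ D(1)]) (use F in auto)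
    then have "\<not> inj F" using finite_imageD[of F UNIV] infinite_UNIV_int by auto
    then obtain i j where ij: "i \<noteq> j" "F i = F j" by (auto simp: inj_def)
    define d where "d = F i"
    have d: "d \<in> carrier G" "d \<noteq> \<one>" using F(1)[of i] D by (auto simp: d_def)
    obtain m n :: int where mn: "m \<noteq> 0" "n \<noteq> 0" "d [^] m = f i [^] n"
      using commensurates_common_power[OF f(1) f1 d, of i] F(2)[of i] by (auto simp: d_def)
    obtain m' n' :: int where mn': "m' \<noteq> 0" "n' \<noteq> 0" "d [^] m' = f j [^] n'"
      using commensurates_common_power[OF f(1) f1 d, of j] F(2)[of j] ij by (auto simp: d_def)
    have "f i [^] (n * m') = (d [^] m) [^] m'" unfolding mn(3) using f by (simp add: int_pow_pow)
    also have "\<dots> = (d [^] m') [^] m" using d by (simp add: int_pow_pow mult.commute)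
    also have "\<dots> = f j [^] (n' * m)" unfolding mn'(3) using f by (simp add: int_pow_pow)
    finally have ff: "f i [^] (n * m') = f j [^] (n' * m)" .
    have kc: "k [^] u \<in> carrier G" for u :: int using k by simp
    have hc: "h [^] u \<in> carrier G" for u :: int using h by simp
    have "k [^] (i - j) \<otimes> h [^] (n * m') = inv (k [^] j) \<otimes> (k [^] i \<otimes> h [^] (n * m'))"
    proof -
      have "k [^] (i - j) = k [^] (- j + i)" by (simp add: algebra_simps)
      also have "\<dots> = inv (k [^] j) \<otimes> k [^] i" using k by (simp only: int_pow_mult int_pow_neg)
      finally show ?thesis using kc hc by (simp add: m_assoc)
    qed
    also have "\<dots> = inv (k [^] j) \<otimes> (f j [^] (n' * m) \<otimes> k [^] i)" by (simp only: fk ff)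
    also have "\<dots> = inv (k [^] j) \<otimes> (f j [^] (n' * m) \<otimes> (k [^] j \<otimes> k [^] (i - j)))"
      using k by (simp add: int_pow_mult[symmetric])
    also have "\<dots> = inv (k [^] j) \<otimes> ((f j [^] (n' * m) \<otimes> k [^] j) \<otimes> k [^] (i - j))"
      using kc f by (simp add: m_assoc)
    also have "\<dots> = inv (k [^] j) \<otimes> ((k [^] j \<otimes> h [^] (n' * m)) \<otimes> k [^] (i - j))" by (simp only: fk)
    also have "\<dots> = h [^] (n' * m) \<otimes> k [^] (i - j)" using kc hc by (simp add: m_assoc[symmetric])
    finally have "commensurates (k [^] (i - j)) h"
      unfolding commensurates_def using mn mn' by (intro exI[of _ "n * m'"] exI[of _ "n' * m"]) simp
    moreover have "k [^] (i - j) \<noteq> \<one>" using int_pow_eq_one[OF k k1] ij by force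
    ultimately obtain a b :: int where ab: "a \<noteq> 0" "b \<noteq> 0" "(k [^] (i - j)) [^] a = h [^] b"
      using commensurates_common_power[OF h h1, of "k [^] (i - j)"] kc by blast
    then have "g \<otimes> h [^] ((i - j) * a) = h [^] b \<otimes> g" using gk[of "(i - j) * a"] k by (simp add: int_pow_pow)
    then show False using g(2) ab ij unfolding commensurates_def by (metis mult_eq_0_iff right_minus_eq)
  qed
  then show ?thesis using f f1 by blast
qed

end

section \<open>Polynomial maps of one variable\<close>

text \<open>
  The word \<open>c\<^sub>0 x\<^sup>\<plusminus> c\<^sub>1 x\<^sup>\<plusminus> \<dots> c\<^sub>n\<close> with constants \<open>c\<^sub>i\<close>. A letter consists of an occurrence of \<open>x\<close>
  (\<open>True\<close>) or \<open>inv x\<close> (\<open>False\<close>) together with the constant after it; the first constant is a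
  separate argument.
\<close>

primrec (in group) word_eval :: "'a \<Rightarrow> (bool \<times> 'a) list \<Rightarrow> 'a \<Rightarrow> 'a" where
  "word_eval c [] x = c"
| "word_eval c (l # ws) x = c \<otimes> ((if fst l then x else inv x) \<otimes> word_eval (snd l) ws x)"

context group begin

definition polynomial_map :: "('a \<Rightarrow> 'a) \<Rightarrow> bool" where
  "polynomial_map f \<longleftrightarrow> (\<exists>c ws. c \<in> carrier G \<and> snd ` set ws \<subseteq> carrier G \<and> (\<forall>x\<in>carrier G. f x = word_eval c ws x))"

lemma word_eval_closed:
  "c \<in> carrier G \<Longrightarrow> snd ` set ws \<subseteq> carrier G \<Longrightarrow> x \<in> carrier G \<Longrightarrow> word_eval c ws x \<in> carrier G"
  by (induction ws arbitrary: c) auto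

lemma word_eval_mult_left:
  "c \<in> carrier G \<Longrightarrow> d \<in> carrier G \<Longrightarrow> snd ` set ws \<subseteq> carrier G \<Longrightarrow> x \<in> carrier G \<Longrightarrow>
   word_eval (c \<otimes> d) ws x = c \<otimes> word_eval d ws x"
  by (cases ws) (auto simp: m_assoc word_eval_closed)

lemma polynomial_map_closed: "polynomial_map f \<Longrightarrow> x \<in> carrier G \<Longrightarrow> f x \<in> carrier G"
  unfolding polynomial_map_def by (auto simp: word_eval_closed)

lemma polynomial_map_cong:
  "polynomial_map f \<Longrightarrow> (\<And>x. x \<in> carrier G \<Longrightarrow> g x = f x) \<Longrightarrow> polynomial_map g"
  unfolding polynomial_map_def by metis

lemma polynomial_map_const: "c \<in> carrier G \<Longrightarrow> polynomial_map (\<lambda>x. c)"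
  unfolding polynomial_map_def by (intro exI[of _ c] exI[of _ "[]"]) simp

lemma polynomial_map_id: "polynomial_map (\<lambda>x. x)"
  unfolding polynomial_map_def by (intro exI[of _ \<one>] exI[of _ "[(True, \<one>)]"]) simp

lemma polynomial_map_inv_id: "polynomial_map (\<lambda>x. inv x)"
  unfolding polynomial_map_def by (intro exI[of _ \<one>] exI[of _ "[(False, \<one>)]"]) simp

lemma polynomial_map_mult:
  assumes "polynomial_map f" and g: "polynomial_map g"
  shows "polynomial_map (\<lambda>x. f x \<otimes> g x)"
proof -
  obtain d vs where d: "d \<in> carrier G" "snd ` set vs \<subseteq> carrier G"
    and gd: "\<And>x. x \<in> carrier G \<Longrightarrow> g x = word_eval d vs x"
    using g unfolding polynomial_map_def by blast
  have *: "\<exists>e us. e \<in> carrier G \<and> snd ` set us \<subseteq> carrier G \<and>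
      (\<forall>x\<in>carrier G. word_eval c ws x \<otimes> g x = word_eval e us x)"
    if "c \<in> carrier G" "snd ` set ws \<subseteq> carrier G" for c ws
    using that
  proof (induction ws arbitrary: c)
    case Nil
    then show ?case using d by (intro exI[of _ "c \<otimes> d"] exI[of _ vs]) (auto simp: gd word_eval_mult_left)
  next
    case (Cons l ws)
    obtain e us where e: "e \<in> carrier G" "snd ` set us \<subseteq> carrier G"
      "\<forall>x\<in>carrier G. word_eval (snd l) ws x \<otimes> g x = word_eval e us x"
      using Cons.IH[of "snd l"] Cons.prems by auto
    have "word_eval c (l # ws) x \<otimes> g x = word_eval c ((fst l, e) # us) x" if x: "x \<in> carrier G" for x
    proof -
      have "word_eval (snd l) ws x \<in> carrier G" using Cons.prems x by (intro word_eval_closed) auto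
      then have "word_eval c (l # ws) x \<otimes> g x
          = c \<otimes> ((if fst l then x else inv x) \<otimes> (word_eval (snd l) ws x \<otimes> g x))"
        using x Cons.prems polynomial_map_closed[OF g x] by (simp add: m_assoc)
      then show ?thesis using e x by simp
    qed
    then show ?case using e Cons.prems by (intro exI[of _ c] exI[of _ "(fst l, e) # us"]) auto
  qed
  obtain c ws where c: "c \<in> carrier G" "snd ` set ws \<subseteq> carrier G"
    and fc: "\<And>x. x \<in> carrier G \<Longrightarrow> f x = word_eval c ws x"
    using assms(1) unfolding polynomial_map_def by blast
  show ?thesis unfolding polynomial_map_def using *[OF c] fc by simp
qed

text \<open>
  The case \<open>cong\<close> is there because being a polynomial map depends on the values on the carrier only.
\<close>

lemma polynomial_map_induct [consumes 1, case_names cong const id inv_id mult]: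
  assumes "polynomial_map f"
    and cong: "\<And>f g. P f \<Longrightarrow> (\<And>x. x \<in> carrier G \<Longrightarrow> g x = f x) \<Longrightarrow> P g"
    and const: "\<And>c. c \<in> carrier G \<Longrightarrow> P (\<lambda>x. c)"
    and id: "P (\<lambda>x. x)" and inv_id: "P (\<lambda>x. inv x)"
    and mult: "\<And>f g. polynomial_map f \<Longrightarrow> polynomial_map g \<Longrightarrow> P f \<Longrightarrow> P g \<Longrightarrow> P (\<lambda>x. f x \<otimes> g x)"
  shows "P f"
proof -
  have "P (word_eval c ws) \<and> polynomial_map (word_eval c ws)" if "c \<in> carrier G" "snd ` set ws \<subseteq> carrier G" for c ws
    using that
  proof (induction ws arbitrary: c)
    case Nil
    have "word_eval c [] = (\<lambda>x. c)" by auto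
    then show ?case using Nil const polynomial_map_const by simp
  next
    case (Cons l ws)
    let ?y = "\<lambda>x. if fst l then x else inv x"
    have y: "P ?y \<and> polynomial_map ?y"
      using id inv_id polynomial_map_id polynomial_map_inv_id by (cases "fst l") auto
    have w: "P (word_eval (snd l) ws) \<and> polynomial_map (word_eval (snd l) ws)"
      using Cons.IH[of "snd l"] Cons.prems by auto
    have yw: "P (\<lambda>x. ?y x \<otimes> word_eval (snd l) ws x) \<and> polynomial_map (\<lambda>x. ?y x \<otimes> word_eval (snd l) ws x)"
      using y w mult polynomial_map_mult by blast
    have c: "P (\<lambda>x. c) \<and> polynomial_map (\<lambda>x. c)" using Cons.prems const polynomial_map_const by simp
    have "P (\<lambda>x. c \<otimes> (?y x \<otimes> word_eval (snd l) ws x)) \<and> polynomial_map (\<lambda>x. c \<otimes> (?y x \<otimes> word_eval (snd l) ws x))"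
      using c yw mult[of "\<lambda>x. c" "\<lambda>x. ?y x \<otimes> word_eval (snd l) ws x"]
        polynomial_map_mult[of "\<lambda>x. c" "\<lambda>x. ?y x \<otimes> word_eval (snd l) ws x"] by blast
    moreover have "word_eval c (l # ws) = (\<lambda>x. c \<otimes> (?y x \<otimes> word_eval (snd l) ws x))" by (auto simp: fun_eq_iff)
    ultimately show ?case by simp
  qed
  then have w: "P (word_eval c ws)" if "c \<in> carrier G" "snd ` set ws \<subseteq> carrier G" for c ws
    using that by simp
  obtain c ws where c: "c \<in> carrier G" "snd ` set ws \<subseteq> carrier G"
    and f: "\<And>x. x \<in> carrier G \<Longrightarrow> f x = word_eval c ws x"
    using assms(1) unfolding polynomial_map_def by blast
  show ?thesis by (rule cong[OF w[OF c] f])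
qed

lemma polynomial_map_inv: "polynomial_map f \<Longrightarrow> polynomial_map (\<lambda>x. inv (f x))"
proof (induction rule: polynomial_map_induct)
  case (cong f g)
  show ?case by (rule polynomial_map_cong[OF cong(1)]) (simp add: cong(2))
next
  case (const c)
  then show ?case by (intro polynomial_map_const) simp
next
  case id
  show ?case by (rule polynomial_map_inv_id)
next
  case inv_id
  show ?case by (rule polynomial_map_cong[OF polynomial_map_id]) simp
next
  case (mult f g)
  show ?case
    by (rule polynomial_map_cong[OF polynomial_map_mult[OF mult(4,3)]])
      (use mult(1,2) in \<open>simp add: inv_mult_group polynomial_map_closed\<close>)
qed

lemma polynomial_map_translate:
  assumes "polynomial_map f" and g: "g \<in> carrier G"
  shows "polynomial_map (\<lambda>x. f (g \<otimes> x))"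
  using assms(1)
proof (induction rule: polynomial_map_induct)
  case (cong f f')
  show ?case by (rule polynomial_map_cong[OF cong(1)]) (simp add: cong(2) g)
next
  case (const c)
  then show ?case by (rule polynomial_map_const)
next
  case id
  show ?case by (rule polynomial_map_mult[OF polynomial_map_const[OF g] polynomial_map_id])
next
  case inv_id
  show ?case
    by (rule polynomial_map_inv[OF polynomial_map_mult[OF polynomial_map_const[OF g] polynomial_map_id]])
next
  case (mult f f')
  show ?case by (rule polynomial_map_mult[OF mult(3,4)])
qed

text \<open>
  Two occurrences of the variable with opposite signs are not separated by \<open>\<one>\<close>.
\<close>

abbreviation reduced_word :: "(bool \<times> 'a) list \<Rightarrow> bool" where
  "reduced_word \<equiv> successively (\<lambda>l l'. snd l = \<one> \<longrightarrow> fst l = fst l')"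

lemma not_reduced_word_shorter:
  assumes "\<not> reduced_word ws" "c \<in> carrier G" "snd ` set ws \<subseteq> carrier G"
  shows "\<exists>d vs. d \<in> carrier G \<and> snd ` set vs \<subseteq> carrier G \<and> length vs < length ws
      \<and> (\<forall>x\<in>carrier G. word_eval c ws x = word_eval d vs x)"
  using assms
proof (induction ws arbitrary: c)
  case (Cons l ws)
  show ?case
  proof (cases "reduced_word ws")
    case False
    have l: "snd l \<in> carrier G" "snd ` set ws \<subseteq> carrier G" using Cons.prems(3) by auto
    from Cons.IH[OF False l] obtain d vs where d: "d \<in> carrier G" "snd ` set vs \<subseteq> carrier G"
      "length vs < length ws" "\<forall>x\<in>carrier G. word_eval (snd l) ws x = word_eval d vs x"
      by blast
    have "snd ` set ((fst l, d) # vs) \<subseteq> carrier G" "length ((fst l, d) # vs) < length (l # ws)"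
      using d(1-3) by auto
    moreover have "\<forall>x\<in>carrier G. word_eval c (l # ws) x = word_eval c ((fst l, d) # vs) x"
      using d(4) by simp
    ultimately show ?thesis using Cons.prems(2) by blast
  next
    case True
    then obtain l' vs where ws: "ws = l' # vs" and l: "snd l = \<one>" "fst l \<noteq> fst l'"
      using Cons.prems(1) by (cases ws) auto
    have "word_eval c (l # ws) x = word_eval (c \<otimes> snd l') vs x" if x: "x \<in> carrier G" for x
    proof -
      let ?w = "word_eval (snd l') vs x"
      have w: "?w \<in> carrier G" using Cons.prems ws x by (intro word_eval_closed) auto
      have "word_eval c (l # ws) x = c \<otimes> ?w"
        using l w x ws by (cases "fst l") (simp_all add: m_assoc[symmetric])
      then show ?thesis using Cons.prems ws x by (simp add: word_eval_mult_left)
    qed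
    moreover have "c \<otimes> snd l' \<in> carrier G" "snd ` set vs \<subseteq> carrier G" "length vs < length (l # ws)"
      using Cons.prems(2,3) ws by auto
    ultimately show ?thesis by blast
  qed
qed simp

text \<open>
  A word of minimal length that represents the map is reduced, since a subword \<open>x \<one> inv x\<close> could be
  cancelled and the constants around it multiplied.
\<close>

lemma polynomial_map_reduced_word:
  assumes "polynomial_map f"
  obtains c ws where "c \<in> carrier G" "snd ` set ws \<subseteq> carrier G" "reduced_word ws"
    "\<And>x. x \<in> carrier G \<Longrightarrow> f x = word_eval c ws x"
proof -
  define P where "P n \<longleftrightarrow> (\<exists>c ws. length ws = n \<and> c \<in> carrier G \<and> snd ` set ws \<subseteq> carrier G \<and>
      (\<forall>x\<in>carrier G. f x = word_eval c ws x))" for n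
  have "\<exists>n. P n" using assms unfolding polynomial_map_def P_def by blast
  then have "P (LEAST n. P n)" by (rule LeastI_ex)
  then obtain c ws where c: "length ws = (LEAST n. P n)" "c \<in> carrier G" "snd ` set ws \<subseteq> carrier G"
    "\<forall>x\<in>carrier G. f x = word_eval c ws x" unfolding P_def by blast
  have "reduced_word ws"
  proof (rule ccontr)
    assume "\<not> reduced_word ws"
    then obtain d vs where "d \<in> carrier G" "snd ` set vs \<subseteq> carrier G" "length vs < length ws"
      "\<forall>x\<in>carrier G. word_eval c ws x = word_eval d vs x"
      using not_reduced_word_shorter[of ws c] c by blast
    then have "P (length vs)" using c unfolding P_def by auto
    then show False using \<open>length vs < length ws\<close> c(1) not_less_Least by metis
  qed
  then show thesis using c that by blast
qed

lemma word_eval_foldr: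
  assumes "c \<in> carrier G" "snd ` set ws \<subseteq> carrier G" "x \<in> carrier G"
  shows "word_eval c ws x = c \<otimes> foldr (\<otimes>) (map (\<lambda>l. (if fst l then x else inv x) \<otimes> snd l) ws) \<one>
    \<and> foldr (\<otimes>) (map (\<lambda>l. (if fst l then x else inv x) \<otimes> snd l) ws) \<one> \<in> carrier G"
  using assms
proof (induction ws arbitrary: c)
  case (Cons l ws)
  then show ?case by (auto simp: m_assoc)
qed simp

end

section \<open>Polynomial maps that vanish on a coset\<close>

context torsion_free_hyperbolic begin

text \<open>
  For \<open>c = \<one>\<close> the overlap of \<open>h\<^sup>n\<close> and \<open>h\<^sup>k\<close> is bounded only if they point in opposite directions. This is
  the case needed later, as reducedness forbids the other one.
\<close>

lemma uniform_overlap_bound: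
  assumes h: "h \<in> carrier G" "h \<noteq> \<one>" and A: "finite A" "A \<subseteq> carrier G"
    and nc: "\<And>c. c \<in> A \<Longrightarrow> c \<noteq> \<one> \<Longrightarrow> \<not> commensurates (inv c) h"
  obtains T where "\<And>c (n::int) (k::int). c \<in> A \<Longrightarrow> (c = \<one> \<longrightarrow> n * k \<le> 0) \<Longrightarrow>
      gp \<one> (inv c \<otimes> h [^] n) (h [^] k) \<le> T"
proof -
  define bd where "bd c T \<longleftrightarrow> (\<forall>(n::int) (k::int). (c = \<one> \<longrightarrow> n * k \<le> 0) \<longrightarrow>
      gp \<one> (inv c \<otimes> h [^] n) (h [^] k) \<le> T)" for c T
  have "\<forall>c\<in>A. \<exists>T. bd c T"
  proof
    fix c assume c: "c \<in> A"
    show "\<exists>T. bd c T"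
    proof (cases "c = \<one>")
      case True
      obtain C where C: "quasi_axis h C" using quasi_axisE[OF h] by blast
      have "gp \<one> (inv c \<otimes> h [^] n) (h [^] k) \<le> C" if "c = \<one> \<longrightarrow> n * k \<le> 0" for n k :: int
      proof -
        have "gp (h [^] (0::int)) (h [^] n) (h [^] k) \<le> C"
          by (rule quasi_axisD[OF C h(1)]) (use that True in \<open>auto simp: mult_le_0_iff\<close>)
        then show ?thesis using True h by simp
      qed
      then have "bd c C" unfolding bd_def by blast
      then show ?thesis by (rule exI)
    next
      case False
      have "inv c \<in> carrier G" using A c by auto
      from bounded_overlap_or_commensurates[OF h this nc[OF c False]]
      obtain T where "\<forall>(n::int) (k::int). gp \<one> (inv c \<otimes> h [^] n) (h [^] k) \<le> T" by (rule exE)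
      then have "bd c T" by (simp add: bd_def)
      then show ?thesis by (rule exI)
    qed
  qed
  from bchoice[OF this] obtain T where T: "\<forall>c\<in>A. bd c (T c)" by (rule exE)
  have "gp \<one> (inv c \<otimes> h [^] n) (h [^] k) \<le> Max (insert 0 (T ` A))"
    if c: "c \<in> A" and nk: "c = \<one> \<longrightarrow> n * k \<le> 0" for c and n k :: int
  proof -
    have "gp \<one> (inv c \<otimes> h [^] n) (h [^] k) \<le> T c" using T c nk by (simp add: bd_def)
    also have "\<dots> \<le> Max (insert 0 (T ` A))" using c A by (intro Max_ge) auto
    finally show ?thesis .
  qed
  then show thesis by (rule that)
qed

text \<open>
  The sides of the broken path are the factors \<open>F l = y l \<otimes> snd l\<close>, where \<open>y l\<close> is \<open>h\<^sup>n\<close> or its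
  inverse. The backtracking at a corner is, up to the lengths of the constants, the overlap of the
  axis of \<open>h\<close> with its translate by a constant, hence bounded independently of \<open>n\<close>. For large
  \<open>n\<close> the sides are long, so the path ends farther from \<open>\<one>\<close> than \<open>inv c0\<close> does.
\<close>

lemma reduced_word_nontrivial_on_powers:
  assumes h: "h \<in> carrier G" "h \<noteq> \<one>" and c: "c0 \<in> carrier G" "snd ` set ws \<subseteq> carrier G"
    and red: "reduced_word ws" and ne: "ws \<noteq> []"
    and nc: "\<And>c. c \<in> snd ` set ws \<Longrightarrow> c \<noteq> \<one> \<Longrightarrow> \<not> commensurates (inv c) h"
  shows "finite {n::int. word_eval c0 ws (h [^] n) = \<one>}"
proof -
  obtain T where T: "\<And>c n k. c \<in> snd ` set ws \<Longrightarrow> (c = \<one> \<longrightarrow> (n::int) * (k::int) \<le> 0) \<Longrightarrow>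
      gp \<one> (inv c \<otimes> h [^] n) (h [^] k) \<le> T"
    by (rule uniform_overlap_bound[OF h _ c(2) nc]) auto
  define B where "B = Max (insert 0 ((\<lambda>l. len (snd l)) ` set ws))"
  have B: "len (snd l) \<le> B" if "l \<in> set ws" for l unfolding B_def using that by (intro Max_ge) auto
  define L where "L = 2 * \<bar>T + B\<bar> + 2 * \<delta> + len c0 + 1"
  have "word_eval c0 ws (h [^] n) \<noteq> \<one>" if n: "len (h [^] n) > L + B" for n :: int
  proof
    assume one: "word_eval c0 ws (h [^] n) = \<one>"
    define x where "x = h [^] n"
    have x: "x \<in> carrier G" using h by (simp add: x_def)
    define y where "y l = (if fst l then x else inv x)" for l :: "bool \<times> 'a"
    define F where "F l = y l \<otimes> snd l" for l :: "bool \<times> 'a"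
    have y: "y l \<in> carrier G" "len (y l) = len x" for l using x by (auto simp: y_def len_inv)
    have yh: "y l = h [^] (if fst l then n else - n)" "inv (y l) = h [^] (if fst l then - n else n)" for l
      using h by (auto simp: y_def x_def int_pow_neg)
    have cl: "snd l \<in> carrier G" if "l \<in> set ws" for l using c that by auto
    have F: "F l \<in> carrier G \<and> L \<le> len (F l)" if l: "l \<in> set ws" for l
    proof -
      have "ldist (y l) (F l) = len (snd l)" unfolding F_def using y cl[OF l] by (intro ldist_right) auto
      then have "len x \<le> len (F l) + len (snd l)"
        using ldist_triangle[of \<one> "F l" "y l"] ldist_commute[of "F l" "y l"] y cl[OF l] by (simp add: F_def)
      then show ?thesis using B[OF l] n y cl[OF l] by (simp add: F_def x_def)
    qed
    have "successively (\<lambda>l l'. gp \<one> (inv (F l)) (F l') \<le> \<bar>T + B\<bar>) ws"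
    proof (rule successively_mono[OF red])
      fix l l' assume l: "l \<in> set ws" "l' \<in> set ws" and r: "snd l = \<one> \<longrightarrow> fst l = fst l'"
      have i: "inv (F l) = inv (snd l) \<otimes> inv (y l)" using y cl l by (simp add: F_def inv_mult_group)
      have "gp \<one> (inv (F l)) (F l') \<le> gp \<one> (inv (F l)) (y l') + ldist (F l') (y l')"
        using F y l by (intro gp_move_right) auto
      also have "ldist (F l') (y l') = len (snd l')"
        using ldist_right[of "y l'" "snd l'"] ldist_commute[of "y l'" "F l'"] F y cl l by (simp add: F_def)
      also have "\<dots> \<le> B" using B l by simp
      also have "gp \<one> (inv (F l)) (y l') \<le> T"
        unfolding i unfolding yh(2) unfolding yh(1) using l r by (intro T) (auto simp: mult_le_0_iff)
      finally show "gp \<one> (inv (F l)) (F l') \<le> \<bar>T + B\<bar>" by linarith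
    qed
    then have "successively (\<lambda>s t. gp \<one> (inv s) t \<le> \<bar>T + B\<bar>) (map F ws)"
      by (simp add: successively_map)
    moreover have "2 * \<bar>T + B\<bar> + 2 * \<delta> < L" using len_nonneg[OF c(1)] by (simp add: L_def)
    moreover have "\<forall>t\<in>set (map F ws). t \<in> carrier G \<and> L \<le> len t" using F by simp
    moreover have "map F ws \<noteq> []" using ne by simp
    ultimately have "L \<le> len (foldr (\<otimes>) (map F ws) \<one>)" using chain_length by blast
    moreover have P: "foldr (\<otimes>) (map F ws) \<one> \<in> carrier G" "\<one> = c0 \<otimes> foldr (\<otimes>) (map F ws) \<one>"
      using word_eval_foldr[OF c x] one unfolding F_def y_def x_def[symmetric] by auto
    have "foldr (\<otimes>) (map F ws) \<one> = inv c0 \<otimes> (c0 \<otimes> foldr (\<otimes>) (map F ws) \<one>)"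
      using c P(1) by (simp add: m_assoc[symmetric])
    then have "foldr (\<otimes>) (map F ws) \<one> = inv c0" using c by (simp add: P(2)[symmetric])
    ultimately show False using c len_nonneg[OF c(1)] delta_nonneg abs_ge_zero[of "T + B"] by (simp add: len_inv L_def)
  qed
  then have "{n::int. word_eval c0 ws (h [^] n) = \<one>} \<subseteq> {n. len (h [^] n) \<le> L + B}" by force
  then show ?thesis using finite_short_powers[OF h] by (rule finite_subset)
qed

text \<open>
  Translation by \<open>g\<close> turns the coset into \<open>H\<close> itself. If the variable occurs in a reduced word for the
  translated map, then that word is nontrivial at almost all powers of a generic \<open>h \<in> H\<close>; only one
  of these powers can be the exceptional point \<open>z\<close>. So the map is constant, and its value is taken
  on the coset.
\<close>

lemma polynomial_map_vanishing_on_coset: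
  assumes nvc: "\<not> virtually_cyclic G" and H: "H \<lhd> G" "H \<noteq> {\<one>}" and f: "polynomial_map f"
    and g: "g \<in> carrier G" and van: "\<And>x. x \<in> H \<Longrightarrow> g \<otimes> x \<noteq> z \<Longrightarrow> f (g \<otimes> x) = \<one>"
    and x: "x \<in> carrier G"
  shows "f x = \<one>"
proof -
  interpret H: normal H G by fact
  obtain c ws where c: "c \<in> carrier G" "snd ` set ws \<subseteq> carrier G" and red: "reduced_word ws"
    and fc: "\<And>x. x \<in> carrier G \<Longrightarrow> f (g \<otimes> x) = word_eval c ws x"
    by (rule polynomial_map_reduced_word[OF polynomial_map_translate[OF f g]]) blast
  let ?D = "(\<lambda>c. inv c) ` (snd ` set ws - {\<one>})"
  have "\<one> \<notin> ?D"
  proof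
    assume "\<one> \<in> ?D"
    then obtain b where b: "b \<in> snd ` set ws" "b \<noteq> \<one>" "\<one> = inv b" by blast
    then have "b \<in> carrier G" using c by blast
    then show False using b inv_eq_1_iff[of b] by simp
  qed
  moreover have "?D \<subseteq> carrier G" "finite ?D" using c by auto
  ultimately obtain h where hH: "h \<in> H" and h1: "h \<noteq> \<one>" and nc: "\<forall>d\<in>?D. \<not> commensurates d h"
    using normal_subgroup_generic_element[OF nvc H, of ?D] by blast
  have h: "h \<in> carrier G" using hH by simp
  have hn: "h [^] n \<in> H" for n :: int using subgroup_int_pow_closed[OF H.subgroup_axioms hH] .
  have "g \<otimes> h [^] m = g \<otimes> h [^] n \<longleftrightarrow> m = n" for m n :: int using int_pow_inject[OF h h1] g h by auto
  then have "inj (\<lambda>n::int. g \<otimes> h [^] n)" by (simp add: inj_def)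
  then have "finite ((\<lambda>n::int. g \<otimes> h [^] n) -` {z})" by (intro finite_vimageI) auto
  moreover have "UNIV \<subseteq> (\<lambda>n::int. g \<otimes> h [^] n) -` {z} \<union> {n::int. word_eval c ws (h [^] n) = \<one>}"
    using van[OF hn] fc h by (auto simp: int_pow_closed)
  ultimately have inf: "infinite {n::int. word_eval c ws (h [^] n) = \<one>}"
    using infinite_UNIV_int finite_subset[of UNIV] by (meson finite_UnI)
  have "ws = []"
  proof (rule ccontr)
    assume "ws \<noteq> []"
    then have "finite {n::int. word_eval c ws (h [^] n) = \<one>}"
      by (rule reduced_word_nontrivial_on_powers[OF h h1 c red]) (use nc in blast)
    then show False using inf by blast
  qed
  moreover from this have "c = \<one>" using inf by (cases "c = \<one>") auto
  moreover have "f x = word_eval c ws (inv g \<otimes> x)" using fc[of "inv g \<otimes> x"] g x by (simp add: m_assoc[symmetric])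
  ultimately show ?thesis by simp
qed

end

section \<open>The word metric of a hyperbolic group\<close>

context group begin

lemma foldr_mult_append:
  "set us \<subseteq> carrier G \<Longrightarrow> set vs \<subseteq> carrier G \<Longrightarrow>
    foldr (\<otimes>) (us @ vs) \<one> = foldr (\<otimes>) us \<one> \<otimes> foldr (\<otimes>) vs \<one>"
  by (induction us) (auto simp: m_assoc)

lemma foldr_mult_inv:
  "set us \<subseteq> carrier G \<Longrightarrow> foldr (\<otimes>) (rev (map (\<lambda>x. inv x) us)) \<one> = inv (foldr (\<otimes>) us \<one>)"
proof (induction us)
  case (Cons u us)
  have "foldr (\<otimes>) (rev (map (\<lambda>x. inv x) (u # us))) \<one>
      = foldr (\<otimes>) (rev (map (\<lambda>x. inv x) us)) \<one> \<otimes> foldr (\<otimes>) [inv u] \<one>"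
    unfolding list.map rev.simps using Cons.prems by (intro foldr_mult_append) auto
  then show ?case using Cons by (simp add: inv_mult_group)
qed simp

lemma generate_imp_word:
  assumes S: "S \<subseteq> carrier G" and x: "x \<in> generate G S"
  shows "\<exists>ws. set ws \<subseteq> S \<union> (\<lambda>s. inv s) ` S \<and> foldr (\<otimes>) ws \<one> = x"
  using x
proof (induction rule: generate.induct)
  case one
  show ?case by (intro exI[of _ "[]"]) simp
next
  case (incl h)
  then show ?case using S by (intro exI[of _ "[h]"]) auto
next
  case (inv h)
  then show ?case using S by (intro exI[of _ "[inv h]"]) auto
next
  case (eng h1 h2)
  then obtain us vs where w: "set us \<subseteq> S \<union> (\<lambda>s. inv s) ` S" "foldr (\<otimes>) us \<one> = h1"
    "set vs \<subseteq> S \<union> (\<lambda>s. inv s) ` S" "foldr (\<otimes>) vs \<one> = h2" by blast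
  have "set us \<subseteq> carrier G" "set vs \<subseteq> carrier G" using w S by auto
  then have "foldr (\<otimes>) (us @ vs) \<one> = h1 \<otimes> h2" using foldr_mult_append[of us vs] w by (simp del: foldr_append)
  then show ?case using w by (intro exI[of _ "us @ vs"]) auto
qed

lemma word_length_le:
  "set ws \<subseteq> S \<union> (\<lambda>s. inv s) ` S \<Longrightarrow> word_length G S (foldr (\<otimes>) ws \<one>) \<le> length ws"
  unfolding word_length_def by (rule Least_le) blast

lemma shortest_word:
  assumes S: "S \<subseteq> carrier G" "generate G S = carrier G" and x: "x \<in> carrier G"
  obtains ws where "set ws \<subseteq> S \<union> (\<lambda>s. inv s) ` S" "foldr (\<otimes>) ws \<one> = x" "length ws = word_length G S x"
proof -
  let ?P = "\<lambda>n. \<exists>ws. length ws = n \<and> set ws \<subseteq> S \<union> (\<lambda>s. inv s) ` S \<and> foldr (\<otimes>) ws \<one> = x"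
  have "\<exists>n. ?P n" using generate_imp_word[OF S(1), of x] S x by blast
  then have "?P (LEAST n. ?P n)" by (rule LeastI_ex)
  then obtain ws where "length ws = (LEAST n. ?P n)" "set ws \<subseteq> S \<union> (\<lambda>s. inv s) ` S" "foldr (\<otimes>) ws \<one> = x"
    by blast
  then show thesis using that[of ws] by (simp add: word_length_def)
qed

end

lemma gromov_hyperbolic_mono: "gromov_hyperbolic \<delta> M d \<Longrightarrow> \<delta> \<le> \<delta>' \<Longrightarrow> gromov_hyperbolic \<delta>' M d"
  unfolding gromov_hyperbolic_def by fastforce

text \<open>
  Cutting a shortest word for \<open>x\<close> into two halves gives the midpoints.
\<close>

lemma hyperbolic_group_imp_hyperbolic_length:
  assumes "hyperbolic_group G"
  shows "\<exists>len \<delta>. hyperbolic_length G len \<delta>"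
proof -
  interpret group G using assms by (simp add: hyperbolic_group_def)
  obtain S \<delta> where S: "finite S" "S \<subseteq> carrier G" "generate G S = carrier G"
    and hyp: "gromov_hyperbolic \<delta> (carrier G) (word_metric G S)"
    using assms unfolding hyperbolic_group_def by blast
  let ?A = "S \<union> (\<lambda>s. inv\<^bsub>G\<^esub> s) ` S"
  let ?e = "\<lambda>ws. foldr (\<otimes>\<^bsub>G\<^esub>) ws \<one>\<^bsub>G\<^esub>"
  define len where "len x = real (word_length G S x)" for x
  have A: "?A \<subseteq> carrier G" using S by auto
  have inv_le: "len (inv\<^bsub>G\<^esub> x) \<le> len x" if x: "x \<in> carrier G" for x
  proof -
    obtain ws where ws: "set ws \<subseteq> ?A" "?e ws = x" "length ws = word_length G S x"
      using shortest_word[OF S(2,3) x] by blast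
    have "set (rev (map (\<lambda>x. inv\<^bsub>G\<^esub> x) ws)) \<subseteq> ?A" using ws(1) S(2) by (auto simp: subset_iff)
    moreover have "?e (rev (map (\<lambda>x. inv\<^bsub>G\<^esub> x) ws)) = inv\<^bsub>G\<^esub> x" using foldr_mult_inv[of ws] ws A by auto
    ultimately show ?thesis using word_length_le[of "rev (map (\<lambda>x. inv\<^bsub>G\<^esub> x) ws)" S] ws(3)
      by (simp add: len_def)
  qed
  have mult: "len (x \<otimes>\<^bsub>G\<^esub> y) \<le> len x + len y" if xy: "x \<in> carrier G" "y \<in> carrier G" for x y
  proof -
    obtain us where us: "set us \<subseteq> ?A" "?e us = x" "length us = word_length G S x"
      using shortest_word[OF S(2,3) xy(1)] by blast
    obtain vs where vs: "set vs \<subseteq> ?A" "?e vs = y" "length vs = word_length G S y"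
      using shortest_word[OF S(2,3) xy(2)] by blast
    have "?e (us @ vs) = x \<otimes>\<^bsub>G\<^esub> y" 
      using foldr_mult_append[OF subset_trans[OF us(1) A] subset_trans[OF vs(1) A]] us vs by (simp del: foldr_append)
    moreover have "set (us @ vs) \<subseteq> ?A" using us vs by simp
    ultimately show ?thesis using word_length_le[of "us @ vs" S] us(3) vs(3) by (simp add: len_def)
  qed
  have "hyperbolic_length G len (max \<delta> 0)"
  proof (intro hyperbolic_length.intro hyperbolic_length_axioms.intro)
    show "len \<one>\<^bsub>G\<^esub> = 0" using word_length_le[of "[]" S] by (simp add: len_def)
    show "len (inv\<^bsub>G\<^esub> x) = len x" if "x \<in> carrier G" for x
      using inv_le[OF that] inv_le[of "inv\<^bsub>G\<^esub> x"] that by simp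
    show "finite {x \<in> carrier G. len x \<le> r}" for r
    proof -
      have "{x \<in> carrier G. len x \<le> r} \<subseteq> ?e ` {ws. set ws \<subseteq> ?A \<and> length ws \<le> nat \<lfloor>r\<rfloor>}"
      proof
        fix x assume "x \<in> {x \<in> carrier G. len x \<le> r}"
        then have x: "x \<in> carrier G" "len x \<le> r" by auto
        obtain ws where ws: "set ws \<subseteq> ?A" "?e ws = x" "length ws = word_length G S x"
          using shortest_word[OF S(2,3) x(1)] by blast
        then have "length ws \<le> nat \<lfloor>r\<rfloor>" using x(2) by (simp add: len_def le_nat_floor)
        then show "x \<in> ?e ` {ws. set ws \<subseteq> ?A \<and> length ws \<le> nat \<lfloor>r\<rfloor>}" using ws by blast
      qed
      moreover have "finite {ws. set ws \<subseteq> ?A \<and> length ws \<le> nat \<lfloor>r\<rfloor>}"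
        using S(1) by (intro finite_lists_length_le) auto
      ultimately show ?thesis by (rule finite_surj[rotated])
    qed
    show "\<exists>m\<in>carrier G. len m + len (inv\<^bsub>G\<^esub> m \<otimes>\<^bsub>G\<^esub> x) = len x \<and> \<bar>len m - len (inv\<^bsub>G\<^esub> m \<otimes>\<^bsub>G\<^esub> x)\<bar> \<le> 1"
      if x: "x \<in> carrier G" for x
    proof -
      obtain ws where ws: "set ws \<subseteq> ?A" "?e ws = x" "length ws = word_length G S x"
        using shortest_word[OF S(2,3) x] by blast
      define n where "n = length ws div 2"
      define m where "m = ?e (take n ws)"
      have ts: "set (take n ws) \<subseteq> ?A" "set (drop n ws) \<subseteq> ?A"
        using ws(1) set_take_subset[of n ws] set_drop_subset[of n ws] by blast+
      have tc: "set (take n ws) \<subseteq> carrier G" "set (drop n ws) \<subseteq> carrier G"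
        using ts A by blast+
      have m: "m \<in> carrier G" unfolding m_def using tc by (intro multlist_closed)
      have d: "?e (drop n ws) \<in> carrier G" using tc by (intro multlist_closed)
      have "x = m \<otimes>\<^bsub>G\<^esub> ?e (drop n ws)"
        using foldr_mult_append[OF tc] ws(2) by (simp add: m_def)
      then have mx: "inv\<^bsub>G\<^esub> m \<otimes>\<^bsub>G\<^esub> x = ?e (drop n ws)" using m d by (simp add: m_assoc[symmetric])
      have "len m \<le> real n" using word_length_le[OF ts(1)] by (simp add: len_def m_def)
      moreover have "len (inv\<^bsub>G\<^esub> m \<otimes>\<^bsub>G\<^esub> x) \<le> real (length ws - n)"
        using word_length_le[OF ts(2)] unfolding mx by (simp add: len_def)
      moreover have "len x = real (length ws)" using ws by (simp add: len_def)
      moreover have "len x \<le> len m + len (inv\<^bsub>G\<^esub> m \<otimes>\<^bsub>G\<^esub> x)"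
        using mult[of m "inv\<^bsub>G\<^esub> m \<otimes>\<^bsub>G\<^esub> x"] m x by (simp add: m_assoc[symmetric])
      moreover have "n \<le> length ws - n" "length ws - n \<le> n + 1" "n \<le> length ws" unfolding n_def by linarith+
      ultimately have "len m = real n" "len (inv\<^bsub>G\<^esub> m \<otimes>\<^bsub>G\<^esub> x) = real (length ws - n)" "len x = real (length ws)"
        by linarith+
      then show ?thesis using m \<open>n \<le> length ws - n\<close> \<open>length ws - n \<le> n + 1\<close> \<open>n \<le> length ws\<close>
        by (intro bexI[of _ m]) auto
    qed
    have "(\<lambda>x y. len (inv\<^bsub>G\<^esub> x \<otimes>\<^bsub>G\<^esub> y)) = word_metric G S"
      by (simp add: fun_eq_iff len_def word_metric_def)
    then show "gromov_hyperbolic (max \<delta> 0) (carrier G) (\<lambda>x y. len (inv\<^bsub>G\<^esub> x \<otimes>\<^bsub>G\<^esub> y))"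
      using gromov_hyperbolic_mono[OF hyp] by simp
  qed (use mult is_group in auto)
  then show ?thesis by blast
qed

section \<open>Andrews-Curtis transformations\<close>

context group begin

lemma tuples_fun_upd: "u \<in> tuples G k \<Longrightarrow> i < k \<Longrightarrow> x \<in> carrier G \<Longrightarrow> u(i := x) \<in> tuples G k"
  by (auto simp: tuples_def PiE_iff extensional_def)

lemma tuples_nth: "u \<in> tuples G k \<Longrightarrow> i < k \<Longrightarrow> u i \<in> carrier G"
  by (auto simp: tuples_def)

lemma tuples_eqI: "u \<in> tuples G k \<Longrightarrow> v \<in> tuples G k \<Longrightarrow> (\<And>i. i < k \<Longrightarrow> u i = v i) \<Longrightarrow> u = v"
  unfolding tuples_def by (rule PiE_ext) auto

lemma inv_BijGroup_fun_upd:
  assumes i: "i < k"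
    and f: "\<And>u. u \<in> tuples G k \<Longrightarrow> f u \<in> carrier G" and g: "\<And>u. u \<in> tuples G k \<Longrightarrow> g u \<in> carrier G"
    and fg: "\<And>u. u \<in> tuples G k \<Longrightarrow> f (u(i := g u)) = u i"
    and gf: "\<And>u. u \<in> tuples G k \<Longrightarrow> g (u(i := f u)) = u i"
  shows "inv\<^bsub>BijGroup (tuples G k)\<^esub> (\<lambda>u\<in>tuples G k. u(i := f u)) = (\<lambda>u\<in>tuples G k. u(i := g u))"
proof -
  let ?F = "\<lambda>u\<in>tuples G k. u(i := f u)"
  have F: "?F \<in> Bij (tuples G k)"
    using fun_upd_bij_tuples[OF i f g fg gf] by (simp add: BijGroup_def)
  then have inj: "inj_on ?F (tuples G k)" by (simp add: Bij_def bij_betw_def)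
  have "inv_into (tuples G k) ?F u = u(i := g u)" if u: "u \<in> tuples G k" for u
  proof (rule inv_into_f_eq[OF inj])
    show *: "u(i := g u) \<in> tuples G k" using u i g by (intro tuples_fun_upd)
    show "?F (u(i := g u)) = u" using * u fg by simp
  qed
  then show ?thesis by (simp add: inv_BijGroup[OF F] cong: restrict_cong)
qed

text \<open>
  The moves are closed under inverses, so they generate \<open>FAC G k\<close> as a monoid. This is why
  \<open>FAC_induct\<close> below has no case for inverses.
\<close>

lemma inv_AC_move: assumes "\<alpha> \<in> AC_moves G k"
  shows "inv\<^bsub>BijGroup (tuples G k)\<^esub> \<alpha> \<in> AC_moves G k"
  using assms
proof cases
  case (R i j e)
  have c: "u i \<in> carrier G" "u j \<in> carrier G" if "u \<in> tuples G k" for u using that R by (auto simp: tuples_nth)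
  have "inv\<^bsub>BijGroup (tuples G k)\<^esub> \<alpha> = (\<lambda>u\<in>tuples G k. u(i := u i \<otimes> (u j [^] (- e))))"
    unfolding R(1)
    by (rule inv_BijGroup_fun_upd) (use R c in \<open>auto simp: m_assoc int_pow_neg\<close>)
  then show ?thesis using R AC_moves.R[of i k j "- e" G] by auto
next
  case (L i j e)
  have c: "u i \<in> carrier G" "u j \<in> carrier G" if "u \<in> tuples G k" for u using that L by (auto simp: tuples_nth)
  have "inv\<^bsub>BijGroup (tuples G k)\<^esub> \<alpha> = (\<lambda>u\<in>tuples G k. u(i := (u j [^] (- e)) \<otimes> u i))"
    unfolding L(1)
    by (rule inv_BijGroup_fun_upd) (use L c in \<open>auto simp: m_assoc[symmetric] int_pow_neg\<close>)
  then show ?thesis using L AC_moves.L[of i k j "- e" G] by auto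
next
  case (I i)
  have c: "u i \<in> carrier G" if "u \<in> tuples G k" for u using that I by (auto simp: tuples_nth)
  have "inv\<^bsub>BijGroup (tuples G k)\<^esub> \<alpha> = (\<lambda>u\<in>tuples G k. u(i := inv (u i)))"
    unfolding I(1) by (rule inv_BijGroup_fun_upd) (use I c in auto)
  then show ?thesis using I AC_moves.I[of i k G] by auto
next
  case (C i w)
  have c: "u i \<in> carrier G" if "u \<in> tuples G k" for u using that C by (auto simp: tuples_nth)
  have l: "inv w \<otimes> (w \<otimes> x) = x" "w \<otimes> (inv w \<otimes> x) = x" if "x \<in> carrier G" for x
    using that C by (auto simp: m_assoc[symmetric])
  have "inv\<^bsub>BijGroup (tuples G k)\<^esub> \<alpha> = (\<lambda>u\<in>tuples G k. u(i := inv (inv w) \<otimes> u i \<otimes> inv w))"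
    unfolding C(1)
    by (rule inv_BijGroup_fun_upd) (use C c l in \<open>auto simp: m_assoc\<close>)
  then show ?thesis using C AC_moves.C[of i k "inv w" G] by auto
qed

text \<open>
  Elements of \<open>FAC G k\<close> are polynomial maps in several variables. Saying instead that they map
  polynomial curves to polynomial curves keeps to one variable and is preserved by composition for
  trivial reasons.
\<close>

definition polynomial_curve :: "nat \<Rightarrow> ('a \<Rightarrow> nat \<Rightarrow> 'a) \<Rightarrow> bool" where
  "polynomial_curve k v \<longleftrightarrow> (\<forall>x\<in>carrier G. v x \<in> tuples G k) \<and> (\<forall>j<k. polynomial_map (\<lambda>x. v x j))"

lemma polynomial_curve_fun_upd:
  assumes v: "polynomial_curve k v" and i: "i < k" and f: "polynomial_map f"
    and w: "\<And>x. x \<in> carrier G \<Longrightarrow> w x = (v x)(i := f x)"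
  shows "polynomial_curve k w"
  unfolding polynomial_curve_def
proof (intro conjI ballI allI impI)
  fix x assume x: "x \<in> carrier G"
  then show "w x \<in> tuples G k"
    using v i polynomial_map_closed[OF f x] by (simp add: w polynomial_curve_def tuples_fun_upd)
next
  fix j assume j: "j < k"
  show "polynomial_map (\<lambda>x. w x j)"
  proof (cases "j = i")
    case True
    then show ?thesis by (intro polynomial_map_cong[OF f]) (simp add: w)
  next
    case False
    have "polynomial_map (\<lambda>x. v x j)" using v j by (simp add: polynomial_curve_def)
    then show ?thesis by (rule polynomial_map_cong) (simp add: w False)
  qed
qed

lemma polynomial_map_sign_pow:
  assumes "polynomial_map f" "e \<in> {1, -1 :: int}" shows "polynomial_map (\<lambda>x. f x [^] e)"
proof (cases "e = 1")
  case True
  show ?thesis by (rule polynomial_map_cong[OF assms(1)]) (simp add: True polynomial_map_closed[OF assms(1)])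
next
  case False
  then show ?thesis using assms(2)
    by (intro polynomial_map_cong[OF polynomial_map_inv[OF assms(1)]])
      (simp add: int_pow_neg polynomial_map_closed[OF assms(1)])
qed

lemma AC_move_polynomial_curve:
  assumes "\<alpha> \<in> AC_moves G k" and v: "polynomial_curve k v"
  shows "polynomial_curve k (\<lambda>x. \<alpha> (v x))"
proof -
  have vt: "x \<in> carrier G \<Longrightarrow> v x \<in> tuples G k" for x using v by (simp add: polynomial_curve_def)
  have p: "polynomial_map (\<lambda>x. v x j)" if "j < k" for j using v that by (simp add: polynomial_curve_def)
  show ?thesis using assms(1)
  proof cases
    case (R i j e)
    show ?thesis
      by (rule polynomial_curve_fun_upd[OF v R(2) polynomial_map_mult[OF p[OF R(2)] polynomial_map_sign_pow[OF p[OF R(3)] R(5)]]])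
        (simp add: R(1) vt)
  next
    case (L i j e)
    show ?thesis
      by (rule polynomial_curve_fun_upd[OF v L(2) polynomial_map_mult[OF polynomial_map_sign_pow[OF p[OF L(3)] L(5)] p[OF L(2)]]])
        (simp add: L(1) vt)
  next
    case (I i)
    show ?thesis
      by (rule polynomial_curve_fun_upd[OF v I(2) polynomial_map_inv[OF p[OF I(2)]]]) (simp add: I(1) vt)
  next
    case (C i w)
    have "inv w \<in> carrier G" using C by simp
    show ?thesis
      by (rule polynomial_curve_fun_upd[OF v C(2) polynomial_map_mult[OF polynomial_map_mult[OF
            polynomial_map_const[OF \<open>inv w \<in> carrier G\<close>] p[OF C(2)]] polynomial_map_const[OF C(3)]]])
        (simp add: C(1) vt)
  qed
qed

lemma carrier_FAC: "carrier (FAC G k) = generate (BijGroup (tuples G k)) (AC_moves G k)"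
  using AC_moves_subset_BijGroup[of k] by (simp add: FAC_def carrier_subgroup_generated Int_absorb1)

lemma FAC_induct [consumes 1, case_names one move comp]:
  assumes "\<alpha> \<in> carrier (FAC G k)"
    and one: "P (\<lambda>u\<in>tuples G k. u)"
    and move: "\<And>\<alpha>. \<alpha> \<in> AC_moves G k \<Longrightarrow> P \<alpha>"
    and comp: "\<And>\<alpha> \<beta>. \<alpha> \<in> carrier (FAC G k) \<Longrightarrow> \<beta> \<in> carrier (FAC G k) \<Longrightarrow> P \<alpha> \<Longrightarrow> P \<beta> \<Longrightarrow>
      P (compose (tuples G k) \<alpha> \<beta>)"
  shows "P \<alpha>"
proof -
  interpret B: group "BijGroup (tuples G k)" by (rule group_BijGroup)
  have "\<alpha> \<in> generate (BijGroup (tuples G k)) (AC_moves G k)" using assms(1) by (simp add: carrier_FAC)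
  then show ?thesis
  proof (induction rule: generate.induct)
    case one
    have "\<one>\<^bsub>BijGroup (tuples G k)\<^esub> = (\<lambda>u\<in>tuples G k. u)" by (simp add: BijGroup_def)
    then show ?case using assms(2) by (simp only:)
  next
    case (incl h)
    then show ?case by (rule move)
  next
    case (inv h)
    then show ?case by (intro move inv_AC_move)
  next
    case (eng h1 h2)
    have "h1 \<in> Bij (tuples G k)" "h2 \<in> Bij (tuples G k)"
      using B.generate_in_carrier[OF AC_moves_subset_BijGroup eng.hyps(1)]
        B.generate_in_carrier[OF AC_moves_subset_BijGroup eng.hyps(2)] by (simp_all add: BijGroup_def)
    then have "h1 \<otimes>\<^bsub>BijGroup (tuples G k)\<^esub> h2 = compose (tuples G k) h1 h2" by (simp add: BijGroup_def)
    then show ?case using comp eng by (simp add: carrier_FAC)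
  qed
qed

lemma FAC_subset_Bij: "carrier (FAC G k) \<subseteq> Bij (tuples G k)"
proof
  fix \<alpha> assume "\<alpha> \<in> carrier (FAC G k)"
  then have "\<alpha> \<in> carrier (BijGroup (tuples G k))"
    unfolding carrier_FAC by (rule group.generate_in_carrier[OF group_BijGroup AC_moves_subset_BijGroup])
  then show "\<alpha> \<in> Bij (tuples G k)" by (simp add: BijGroup_def)
qed

lemma FAC_polynomial_curve:
  assumes "\<alpha> \<in> carrier (FAC G k)" "polynomial_curve k v"
  shows "polynomial_curve k (\<lambda>x. \<alpha> (v x))"
  using assms
proof (induction arbitrary: v rule: FAC_induct)
  case one
  then have "x \<in> carrier G \<Longrightarrow> v x \<in> tuples G k" for x by (simp add: polynomial_curve_def)
  then show ?case using one unfolding polynomial_curve_def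
    by (auto intro: polynomial_map_cong[where f = "\<lambda>x. v x j" for j])
next
  case (move \<alpha>)
  then show ?case by (rule AC_move_polynomial_curve)
next
  case (comp \<alpha> \<beta>)
  have 1: "polynomial_curve k (\<lambda>x. \<alpha> (\<beta> (v x)))" using comp by blast
  have "x \<in> carrier G \<Longrightarrow> v x \<in> tuples G k" for x using comp.prems by (simp add: polynomial_curve_def)
  then have e: "compose (tuples G k) \<alpha> \<beta> (v x) = \<alpha> (\<beta> (v x))" if "x \<in> carrier G" for x
    using that by (simp add: compose_def)
  have "polynomial_map (\<lambda>x. compose (tuples G k) \<alpha> \<beta> (v x) j)" if "j < k" for j
    by (rule polynomial_map_cong[where f = "\<lambda>x. \<alpha> (\<beta> (v x)) j"]) (use 1 e that in \<open>auto simp: polynomial_curve_def\<close>)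
  then show ?case using 1 e by (simp add: polynomial_curve_def)
qed

lemma FAC_image_normal_generating_tuples:
  assumes "\<alpha> \<in> carrier (FAC G k)"
  shows "\<alpha> ` normal_generating_tuples G k = normal_generating_tuples G k"
  using assms
proof (induction rule: FAC_induct)
  case one
  show ?case by (auto simp: normal_generating_tuples_def)
next
  case (move \<alpha>)
  then have "restrict \<alpha> (normal_generating_tuples G k) \<in> Bij (normal_generating_tuples G k)"
    using restrict_AC_moves_subset_BijGroup[of k] by (auto simp: BijGroup_def)
  then show ?case by (simp add: Bij_def bij_betw_def)
next
  case (comp \<alpha> \<beta>)
  have "compose (tuples G k) \<alpha> \<beta> ` normal_generating_tuples G k = \<alpha> ` \<beta> ` normal_generating_tuples G k"
    by (auto simp: normal_generating_tuples_def compose_def image_iff)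
  then show ?case using comp by simp
qed

lemma group_FAC: "group (FAC G k)"
  unfolding FAC_def by (rule group.group_subgroup_generated[OF group_BijGroup])

lemma restrict_FAC_Bij:
  assumes "\<alpha> \<in> carrier (FAC G k)"
  shows "restrict \<alpha> (normal_generating_tuples G k) \<in> Bij (normal_generating_tuples G k)"
proof -
  have "inj_on \<alpha> (tuples G k)" using assms FAC_subset_Bij by (auto simp: Bij_def bij_betw_def)
  then have "inj_on \<alpha> (normal_generating_tuples G k)"
    by (rule inj_on_subset) (auto simp: normal_generating_tuples_def)
  then show ?thesis using FAC_image_normal_generating_tuples[OF assms]
    by (simp add: Bij_def bij_betw_def)
qed

lemma group_hom_AC_restriction:
  "group_hom (FAC G k) (BijGroup (normal_generating_tuples G k)) (AC_restriction G k)"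
proof (rule group_hom.intro[OF group_FAC group_BijGroup], rule group_hom_axioms.intro, rule homI)
  interpret F: group "FAC G k" by (rule group_FAC)
  let ?N = "normal_generating_tuples G k"
  fix \<alpha> \<beta> assume a: "\<alpha> \<in> carrier (FAC G k)" and b: "\<beta> \<in> carrier (FAC G k)"
  then show "AC_restriction G k \<alpha> \<in> carrier (BijGroup ?N)"
    using restrict_FAC_Bij by (simp add: AC_restriction_def BijGroup_def)
  have ab: "\<alpha> \<otimes>\<^bsub>FAC G k\<^esub> \<beta> = compose (tuples G k) \<alpha> \<beta>"
    using a b FAC_subset_Bij by (auto simp: FAC_def BijGroup_def)
  have "restrict (compose (tuples G k) \<alpha> \<beta>) ?N = compose ?N (restrict \<alpha> ?N) (restrict \<beta> ?N)"
    using FAC_image_normal_generating_tuples[OF b]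
    by (auto simp: compose_def restrict_def normal_generating_tuples_def fun_eq_iff image_iff)
  then show "AC_restriction G k (\<alpha> \<otimes>\<^bsub>FAC G k\<^esub> \<beta>)
      = AC_restriction G k \<alpha> \<otimes>\<^bsub>BijGroup ?N\<^esub> AC_restriction G k \<beta>"
    using a b F.m_closed[OF a b] restrict_FAC_Bij[OF a] restrict_FAC_Bij[OF b]
    by (simp add: AC_restriction_def ab BijGroup_def)
qed

lemma AC_restriction_image: "AC_restriction G k ` carrier (FAC G k) = carrier (AC G k)"
proof -
  interpret h: group_hom "FAC G k" "BijGroup (normal_generating_tuples G k)" "AC_restriction G k"
    by (rule group_hom_AC_restriction)
  let ?M = "AC_moves G k" and ?N = "normal_generating_tuples G k"
  have M: "?M \<subseteq> carrier (FAC G k)" by (auto simp: carrier_FAC intro: generate.incl)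
  have "generate (FAC G k) ?M = carrier (subgroup_generated (FAC G k) ?M)"
    using M by (simp add: carrier_subgroup_generated Int_absorb1)
  also have "\<dots> = carrier (FAC G k)"
    unfolding FAC_def group.subgroup_generated2[OF group_BijGroup] ..
  finally have "AC_restriction G k ` carrier (FAC G k) = generate (BijGroup ?N) (AC_restriction G k ` ?M)"
    using h.generate_img[OF M] by simp
  also have "AC_restriction G k ` ?M = (\<lambda>\<alpha>. restrict \<alpha> ?N) ` ?M"
    using M by (intro image_cong) (auto simp: AC_restriction_def)
  also have "generate (BijGroup ?N) \<dots> = carrier (AC G k)"
    using restrict_AC_moves_subset_BijGroup[of k] by (simp add: AC_def carrier_subgroup_generated Int_absorb1)
  finally show ?thesis .
qed

section \<open>Transformations that fix all normal generating tuples\<close>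

lemma normal_closure_normal: assumes "A \<subseteq> carrier G" shows "normal_closure G A \<lhd> G"
proof (rule normal_invI)
  have g: "carrier G \<in> {N. N \<lhd> G \<and> A \<subseteq> N}" using assms normal_self by blast
  show "subgroup (normal_closure G A) G"
    unfolding normal_closure_def using g by (intro subgroups_Inter) (auto intro: normal_imp_subgroup)
  fix x h assume "x \<in> carrier G" "h \<in> normal_closure G A"
  then show "x \<otimes> h \<otimes> inv x \<in> normal_closure G A"
    unfolding normal_closure_def by (auto intro: normal.inv_op_closed2)
qed

lemma normal_closure_incl: "x \<in> A \<Longrightarrow> x \<in> normal_closure G A"
  unfolding normal_closure_def by blast

lemma normal_closure_subset_normal: "N \<lhd> G \<Longrightarrow> A \<subseteq> N \<Longrightarrow> normal_closure G A \<subseteq> N"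
  unfolding normal_closure_def by blast

lemma trivial_imp_virtually_cyclic: assumes "carrier G = {\<one>}" shows "virtually_cyclic G"
proof -
  have "finite (rcosets {\<one>})" unfolding RCOSETS_def using assms by simp
  moreover have "subgroup {\<one>} G" by (rule triv_subgroup)
  ultimately show ?thesis unfolding virtually_cyclic_def using cyclic_group_generated by blast
qed

text \<open>
  Since \<open>G\<close> is nontrivial, some entry of a normally generating tuple is nontrivial; if it is the only
  one, a move multiplies it into another entry.
\<close>

lemma exists_two_nontrivial_entries:
  assumes nvc: "\<not> virtually_cyclic G" and k: "k \<ge> 2" and ne: "normal_generating_tuples G k \<noteq> {}"
  shows "\<exists>u\<in>normal_generating_tuples G k. \<exists>i<k. \<exists>j<k. i \<noteq> j \<and> u i \<noteq> \<one> \<and> u j \<noteq> \<one>"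
proof -
  obtain u where u: "u \<in> normal_generating_tuples G k" using ne by blast
  then have ut: "u \<in> tuples G k" and un: "normal_closure G (u ` {..<k}) = carrier G"
    by (auto simp: normal_generating_tuples_def)
  have "\<exists>i<k. u i \<noteq> \<one>"
  proof (rule ccontr)
    assume "\<not> ?thesis"
    then have "u ` {..<k} \<subseteq> {\<one>}" by auto
    then have "carrier G \<subseteq> {\<one>}" using normal_closure_subset_normal[OF one_is_normal] un by blast
    then have "carrier G = {\<one>}" by auto
    then show False using trivial_imp_virtually_cyclic nvc by blast
  qed
  then obtain i where i: "i < k" "u i \<noteq> \<one>" by blast
  obtain j where j: "j < k" "j \<noteq> i" using k by (cases "i = 0") (auto intro: that[of 1] that[of 0])
  show ?thesis
  proof (cases "u j = \<one>")
    case True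
    let ?\<alpha> = "\<lambda>u\<in>tuples G k. u(j := u j \<otimes> u i [^] (1::int))"
    have m: "?\<alpha> \<in> AC_moves G k" using AC_moves.R[of j k i 1 G] i j by auto
    have e: "?\<alpha> u = u(j := u i)" using ut True i tuples_nth[OF ut i(1)] by simp
    have "u(j := u i) \<in> normal_generating_tuples G k"
      using normal_closure_AC_moves[OF m ut] un tuples_fun_upd[OF ut j(1) tuples_nth[OF ut i(1)]]
      unfolding e normal_generating_tuples_def by simp
    then show ?thesis using i j by (intro bexI[of _ "u(j := u i)"] exI[of _ i] exI[of _ j]) auto
  next
    case False
    then show ?thesis using u i j by blast
  qed
qed

end

context torsion_free_hyperbolic begin

text \<open>
  The induction over \<open>s\<close> shows that \<open>\<alpha>\<close> fixes every tuple that agrees from the index \<open>s\<close> on with a good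
  one, where good tuples generate \<open>G\<close> normally and have two nontrivial entries. In the step, the
  entry \<open>s\<close> of the good tuple \<open>u\<close> may vary in the coset of \<open>u s\<close> modulo the normal closure \<open>H\<close> of the
  other entries, except for the value \<open>\<one>\<close>, which may leave only one nontrivial entry. On that part
  of the coset the induction hypothesis gives the equation \<open>\<alpha> v = v\<close> with \<open>x\<close> in place of \<open>v s\<close>, and
  an equation in one variable that holds there holds for all \<open>x\<close>.
\<close>

lemma FAC_fixing_normal_generating_tuples:
  assumes nvc: "\<not> virtually_cyclic G" and k: "k \<ge> 2" and ne: "normal_generating_tuples G k \<noteq> {}"
    and \<alpha>: "\<alpha> \<in> carrier (FAC G k)" and fix_N: "\<And>u. u \<in> normal_generating_tuples G k \<Longrightarrow> \<alpha> u = u"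
    and v: "v \<in> tuples G k"
  shows "\<alpha> v = v"
proof -
  let ?N = "normal_generating_tuples G k"
  define good where "good u \<longleftrightarrow> u \<in> ?N \<and> (\<exists>i<k. \<exists>j<k. i \<noteq> j \<and> u i \<noteq> \<one> \<and> u j \<noteq> \<one>)" for u
  have \<alpha>t: "\<alpha> u \<in> tuples G k" if "u \<in> tuples G k" for u
    using \<alpha> FAC_subset_Bij that Bij_imp_funcset by blast
  have step: "\<forall>u v. good u \<longrightarrow> v \<in> tuples G k \<longrightarrow> (\<forall>j. s \<le> j \<and> j < k \<longrightarrow> v j = u j) \<longrightarrow> \<alpha> v = v" if "s \<le> k" for s
    using that
  proof (induction s)
    case 0
    show ?case
    proof (intro allI impI)
      fix u v assume u: "good u" and v: "v \<in> tuples G k" and "\<forall>j. 0 \<le> j \<and> j < k \<longrightarrow> v j = u j"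
      then have "v = u" by (intro tuples_eqI) (auto simp: good_def normal_generating_tuples_def)
      then show "\<alpha> v = v" using fix_N u by (simp add: good_def)
    qed
  next
    case (Suc s)
    have s: "s < k" using Suc.prems by simp
    show ?case
    proof (intro allI impI)
      fix u v assume u: "good u" and v: "v \<in> tuples G k" and vu: "\<forall>j. Suc s \<le> j \<and> j < k \<longrightarrow> v j = u j"
      have ut: "u \<in> tuples G k" and un: "normal_closure G (u ` {..<k}) = carrier G"
        using u by (auto simp: good_def normal_generating_tuples_def)
      have us: "u s \<in> carrier G" using tuples_nth[OF ut s] .
      obtain a b where "a < k" "b < k" "a \<noteq> b" "u a \<noteq> \<one>" "u b \<noteq> \<one>" using u unfolding good_def by blast
      then obtain j where j: "j < k" "j \<noteq> s" "u j \<noteq> \<one>" by (cases "a = s") auto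
      let ?A = "u ` ({..<k} - {s})"
      define H where "H = normal_closure G ?A"
      have A: "?A \<subseteq> carrier G" using tuples_nth[OF ut] by auto
      have H: "H \<lhd> G" unfolding H_def by (rule normal_closure_normal[OF A])
      have "u j \<in> H" unfolding H_def using j by (intro normal_closure_incl) auto
      then have H1: "H \<noteq> {\<one>}" using j by auto
      have Hc: "h \<in> carrier G" if "h \<in> H" for h
        by (rule subgroup.mem_carrier[OF normal_imp_subgroup[OF H] that])
      have fixed: "\<alpha> (v(s := u s \<otimes> h)) = v(s := u s \<otimes> h)" if h: "h \<in> H" and n1: "u s \<otimes> h \<noteq> \<one>" for h
      proof -
        let ?u = "u(s := u s \<otimes> h)"
        have ht: "?u \<in> tuples G k" "v(s := u s \<otimes> h) \<in> tuples G k"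
          using ut v s us Hc[OF h] by (auto intro!: tuples_fun_upd)
        have "normal_closure G (?u ` {..<k}) = normal_closure G (u ` {..<k})"
        proof (rule normal_closure_fun_upd[OF s])
          fix N assume N: "N \<lhd> G" "\<forall>j<k. j \<noteq> s \<longrightarrow> u j \<in> N"
          interpret N: normal N G by fact
          have "H \<subseteq> N" unfolding H_def using N by (intro normal_closure_subset_normal) auto
          then have hN: "h \<in> N" using h by blast
          show "(u s \<otimes> h \<in> N) = (u s \<in> N)"
          proof
            assume "u s \<otimes> h \<in> N"
            from N.m_closed[OF this N.m_inv_closed[OF hN]]
            show "u s \<in> N" using us Hc[OF h] by (simp add: m_assoc)
          qed (use hN in auto)
        qed
        then have "?u \<in> ?N" using ht un by (simp add: normal_generating_tuples_def del: fun_upd_image)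
        moreover have "s \<noteq> j" "?u s \<noteq> \<one>" "?u j \<noteq> \<one>" using j n1 by auto
        ultimately have "good ?u" unfolding good_def using j(1) s by blast
        moreover have "\<forall>j. s \<le> j \<and> j < k \<longrightarrow> (v(s := u s \<otimes> h)) j = ?u j" using vu by auto
        ultimately show ?thesis using Suc ht by auto
      qed
      have curve: "polynomial_curve k (\<lambda>x. v(s := x))"
      proof (rule polynomial_curve_fun_upd[OF _ s polynomial_map_id])
        show "polynomial_curve k (\<lambda>x. v)"
          using v tuples_nth by (auto simp: polynomial_curve_def intro: polynomial_map_const)
      qed simp
      have "(\<alpha> v) i = v i" if i: "i < k" for i
      proof -
        let ?f = "\<lambda>x. \<alpha> (v(s := x)) i \<otimes> inv ((v(s := x)) i)"
        have p1: "polynomial_map (\<lambda>x. \<alpha> (v(s := x)) i)"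
          using FAC_polynomial_curve[OF \<alpha> curve] i by (simp add: polynomial_curve_def)
        have p2: "polynomial_map (\<lambda>x. inv ((v(s := x)) i))"
          using curve i by (intro polynomial_map_inv) (simp add: polynomial_curve_def)
        have "?f (v s) = \<one>"
        proof (rule polynomial_map_vanishing_on_coset[OF nvc H H1 polynomial_map_mult[OF p1 p2] us])
          fix h assume h: "h \<in> H" "u s \<otimes> h \<noteq> \<one>"
          have "v(s := u s \<otimes> h) \<in> tuples G k" using v s us Hc[OF h(1)] by (intro tuples_fun_upd) auto
          then have "(v(s := u s \<otimes> h)) i \<in> carrier G" using i by (rule tuples_nth)
          then show "?f (u s \<otimes> h) = \<one>" unfolding fixed[OF h] by (rule r_inv)
        qed (use tuples_nth[OF v s] in auto)
        then have "\<alpha> v i \<otimes> inv (v i) = \<one>" by simp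
        then show ?thesis using tuples_nth[OF v i] tuples_nth[OF \<alpha>t[OF v] i]
          by (metis inv_closed inv_equality inv_inv)
      qed
      then show "\<alpha> v = v" by (rule tuples_eqI[OF \<alpha>t[OF v] v])
    qed
  qed
  obtain u where "good u" using exists_two_nontrivial_entries[OF nvc k ne] unfolding good_def by blast
  moreover have "\<forall>j. k \<le> j \<and> j < k \<longrightarrow> v j = u j" using leD by blast
  ultimately show ?thesis using step[OF order_refl] v by blast
qed

end

theorem corollary2p2:
  fixes G :: "('a, 'b) monoid_scheme" and k :: nat
  assumes "hyperbolic_group G"
    and "\<not> virtually_cyclic G"
    and "torsion_free G"
    and "k \<ge> 2"
    and "normal_generating_tuples G k \<noteq> {}"
  shows "AC_restriction G k \<in> iso (FAC G k) (AC G k)"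
proof -
  obtain len \<delta> where hl: "hyperbolic_length G len \<delta>"
    using hyperbolic_group_imp_hyperbolic_length[OF assms(1)] by blast
  interpret torsion_free_hyperbolic G len \<delta>
    using hl assms(3) by (simp add: torsion_free_hyperbolic_def torsion_free_hyperbolic_axioms_def)
  let ?N = "normal_generating_tuples G k"
  interpret h: group_hom "FAC G k" "BijGroup ?N" "AC_restriction G k"
    by (rule group_hom_AC_restriction)
  have "inj_on (AC_restriction G k) (carrier (FAC G k))"
    unfolding h.inj_on_one_iff
  proof (intro allI impI)
    fix \<alpha> assume \<alpha>: "\<alpha> \<in> carrier (FAC G k)" and one: "AC_restriction G k \<alpha> = \<one>\<^bsub>BijGroup ?N\<^esub>"
    have "restrict \<alpha> ?N = (\<lambda>u\<in>?N. u)" using one \<alpha> by (simp add: AC_restriction_def BijGroup_def)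
    then have "\<alpha> u = u" if "u \<in> ?N" for u using that by (metis restrict_apply')
    then have id: "\<alpha> v = v" if "v \<in> tuples G k" for v
      using FAC_fixing_normal_generating_tuples[OF assms(2,4,5) \<alpha>] that by blast
    have "\<alpha> \<in> extensional (tuples G k)" using \<alpha> FAC_subset_Bij Bij_imp_extensional by blast
    then have "\<alpha> = (\<lambda>v\<in>tuples G k. v)" using id by (intro extensionalityI[of _ "tuples G k"]) auto
    then show "\<alpha> = \<one>\<^bsub>FAC G k\<^esub>" by (simp add: FAC_def BijGroup_def)
  qed
  moreover have "AC_restriction G k \<in> hom (FAC G k) (AC G k)"
    using h.homh AC_restriction_image unfolding hom_def AC_def by auto
  ultimately show ?thesis
    using AC_restriction_image by (simp add: iso_def bij_betw_def)
qed

end
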